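(* Let $0<s<1$ be rational, let $E\subseteq2^\omega$ be a $\Sigma^1_1$ class with $\mathcal H^s(E)>0$, and let $y\in2^\omega$. If $y\le_T x$ for every $x\in2^\omega$ (equivalently, every oracle, including graphs of functions in $\omega^\omega$) such that $E$ has a $\Pi^0_1(x)$ subclass of non-zero $\mathcal H^s$-measure, then $y$ is hyperarithmetic.
   Context: Cantor space $2^\omega$ carries the metric $d(x,y)=2^{-\min\{n:x(n)\ne y(n)\}}$ for $x\ne y$; $\mathcal H^s$ denotes $s$-dimensional Hausdorff measure with respect to this metric. $\le_T$ is Turing reducibility. *)

theory Defs
  imports Complex_Main "HOL-Library.Extended_Nonnegative_Real"
begin

type_synonym cantor = "nat \<Rightarrow> bool"

definition cdist :: "cantor \<Rightarrow> cantor \<Rightarrow> real" where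
  "cdist x y = (if x = y then 0 else (1/2) ^ (LEAST n. x n \<noteq> y n))"

definition cdiam :: "cantor set \<Rightarrow> real" where
  "cdiam U = (if U = {} then 0 else Sup {cdist x y | x y. x \<in> U \<and> y \<in> U})"

definition hausdorff_approx :: "real \<Rightarrow> real \<Rightarrow> cantor set \<Rightarrow> ennreal" where
  "hausdorff_approx s \<delta> A =
     (INF U \<in> {U :: nat \<Rightarrow> cantor set. (\<forall>i. cdiam (U i) \<le> \<delta>) \<and> A \<subseteq> (\<Union>i. U i)}.
        (\<Sum>i. ennreal (cdiam (U i) powr s)))"

definition hausdorff_measure :: "real \<Rightarrow> cantor set \<Rightarrow> ennreal" where
  "hausdorff_measure s A = (SUP \<delta> \<in> {0<..}. hausdorff_approx s \<delta> A)"

datatype rcode = RZero | RSuc | RProj nat | RComp rcode "rcode list" | RPrim rcode rcode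
  | RMu rcode | ROracle

inductive eval :: "(nat \<Rightarrow> nat) \<Rightarrow> rcode \<Rightarrow> nat list \<Rightarrow> nat \<Rightarrow> bool" for f where
  zero: "eval f RZero xs 0"
| suc: "eval f RSuc (x # xs) (Suc x)"
| proj: "i < length xs \<Longrightarrow> eval f (RProj i) xs (xs ! i)"
| orc: "eval f ROracle (x # xs) (f x)"
| comp: "list_all2 (\<lambda>h w. eval f h xs w) hs ws \<Longrightarrow> eval f g ws v \<Longrightarrow> eval f (RComp g hs) xs v"
| prim0: "eval f g xs v \<Longrightarrow> eval f (RPrim g h) (0 # xs) v"
| primS: "eval f (RPrim g h) (n # xs) u \<Longrightarrow> eval f h (n # u # xs) v
           \<Longrightarrow> eval f (RPrim g h) (Suc n # xs) v"
| mu: "eval f g (n # xs) 0 \<Longrightarrow> (\<forall>m<n. \<exists>w. eval f g (m # xs) (Suc w))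
           \<Longrightarrow> eval f (RMu g) xs n"

definition halts :: "(nat \<Rightarrow> nat) \<Rightarrow> rcode \<Rightarrow> nat list \<Rightarrow> bool" where
  "halts f c xs = (\<exists>v. eval f c xs v)"

definition b2n :: "cantor \<Rightarrow> nat \<Rightarrow> nat" where
  "b2n z = (\<lambda>n. if z n then 1 else 0)"

definition ojoin :: "(nat \<Rightarrow> nat) \<Rightarrow> (nat \<Rightarrow> nat) \<Rightarrow> nat \<Rightarrow> nat" where
  "ojoin f g = (\<lambda>n. if even n then f (n div 2) else g (n div 2))"

definition turing_le :: "cantor \<Rightarrow> cantor \<Rightarrow> bool" where
  "turing_le y x = (\<exists>c. \<forall>n. eval (b2n x) c [n] (b2n y n))"

definition pi01_rel :: "cantor \<Rightarrow> cantor set \<Rightarrow> bool" where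
  "pi01_rel x P = (\<exists>c. \<forall>z. z \<in> P \<longleftrightarrow> \<not> halts (ojoin (b2n x) (b2n z)) c [0])"

definition sigma11_class :: "cantor set \<Rightarrow> bool" where
  "sigma11_class E = (\<exists>c. \<forall>z. z \<in> E \<longleftrightarrow> (\<exists>g :: nat \<Rightarrow> nat. \<not> halts (ojoin (b2n z) g) c [0]))"

definition sigma11_nat :: "nat set \<Rightarrow> bool" where
  "sigma11_nat A = (\<exists>c. \<forall>n. n \<in> A \<longleftrightarrow> (\<exists>g :: nat \<Rightarrow> nat. \<not> halts g c [n]))"

text \<open>Hyperarithmetic = Delta^1_1 (Kleene): both it and its complement are Sigma^1_1.\<close>
definition hyperarithmetic :: "cantor \<Rightarrow> bool" where
  "hyperarithmetic y = (sigma11_nat {n. y n} \<and> sigma11_nat {n. \<not> y n})"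

end

(* Write E as the union over h of the sections {z. (z,h) in F} with F a Pi01 class, and let E_g be
   the part of E with a witness h bounded by g pointwise; E_g is compact and Pi01 in the graph of g.

   H^s is replaced by the dyadic content, which has the same null sets but passes to the limit along
   increasing sequences of arbitrary sets: it is strongly subadditive on open sets, because
   truncating at 1 preserves submodularity at every node of the binary tree. Bounding
   h(0), h(1), ... one value at a time therefore yields g such that all partially bounded sections
   have content above a fixed e > 0, and compactness transfers this to E_g. As E_g' contains E_g for
   g' >= g, every g' >= g computes y.

   Force with conditions (l, q): the functions that agree with q below l and dominate q. If every
   condition could be strengthened to exclude each given reduction of y to g', a generic g' >= g
   would not compute y. Hence below some (l, q) the functions computing y via a fixed c are dense,
   and then y(n) = v iff there is h such that no function above h with the stem of q gives a value
   other than v at n via c. This is Sigma11 for either v. *)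

theory Submission
  imports Defs "HOL-Library.Countable" "HOL-Library.Nat_Bijection"
begin

text \<open>The obstacle is uniformity: each function above \<open>G\<close> computes
  \<open>y\<close>, but the reduction may change with the function. Forcing fixes one reduction, on
  a dense set of functions only, so the definition of \<open>y\<close> must quantify over all
  functions above some \<open>h\<close>. Read naively, this is an existential function quantifier
  followed by a universal one. The inner one collapses to numbers: a computation uses finitely many
  oracle values, so a counterexample may be taken to be a fixed stem followed by \<open>h\<close>
  plus increments coded by two numbers, and non-halting of a search with oracle \<open>h\<close>
  remains.

  On the measure side, H^s(E) may be infinite, whereas the content is at most 1. The ratio
  \<open>r\<close> is 2^-s: a cylinder of length n then costs r^n, the s-th power of its diameter.
  The bound r >= 1/2 says that trading a cylinder for its two halves is never cheaper; this gives
  the whole space content 1 and starts the induction for submodularity.\<close>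

instance rcode :: countable
  by countable_datatype

subsection \<open>Bounded evaluation\<close>

text \<open>Values are shifted by one, \<open>0\<close> standing for the absence of a value within the bound. The state
  of an unbounded search is \<open>0\<close> (failed), \<open>1\<close> (still running) or \<open>n + 2\<close> (found \<open>n\<close>). Oracle
  queries are bounded too, so that the value depends only on the oracle below the bound.\<close>

definition mu_step :: "(nat \<Rightarrow> nat) \<Rightarrow> nat \<Rightarrow> nat \<Rightarrow> nat" where
  "mu_step b j u = (if u = 1 then (if b j = 0 then 0 else if b j = 1 then j + 2 else 1) else u)"

fun bev :: "nat \<Rightarrow> (nat \<Rightarrow> nat) \<Rightarrow> rcode \<Rightarrow> nat list \<Rightarrow> nat" where
  "bev t f RZero xs = 1"
| "bev t f RSuc xs = (if xs = [] then 0 else Suc (Suc (hd xs)))"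
| "bev t f (RProj i) xs = (if i < length xs then Suc (xs ! i) else 0)"
| "bev t f ROracle xs = (if xs = [] then 0 else if hd xs < t then Suc (f (hd xs)) else 0)"
| "bev t f (RComp g hs) xs =
     (if \<exists>h\<in>set hs. bev t f h xs = 0 then 0 else bev t f g (map (\<lambda>h. bev t f h xs - 1) hs))"
| "bev t f (RPrim g h) [] = 0"
| "bev t f (RPrim g h) (n # ys) =
     rec_nat (bev t f g ys) (\<lambda>m u. if u = 0 then 0 else bev t f h (m # (u - 1) # ys)) n"
| "bev t f (RMu g) xs = rec_nat 1 (\<lambda>j u. mu_step (\<lambda>j. bev t f g (j # xs)) j u) t - 1"

lemma mu_search_running:
  "rec_nat (Suc 0) (mu_step b) t = Suc 0 \<longleftrightarrow> (\<forall>m<t. b m \<ge> 2)"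
proof (induction t)
  case (Suc t)
  have "mu_step b t S = Suc 0 \<longleftrightarrow> S = Suc 0 \<and> b t \<ge> 2" for S
    by (auto simp: mu_step_def)
  with Suc show ?case
    by (auto simp: less_Suc_eq)
qed simp

lemma mu_search_found:
  "rec_nat (Suc 0) (mu_step b) t = Suc (Suc n) \<longleftrightarrow>
     n < t \<and> b n = 1 \<and> (\<forall>m<n. b m \<ge> 2)"
proof (induction t)
  case (Suc t)
  have "mu_step b t S = Suc (Suc n) \<longleftrightarrow> S = Suc (Suc n) \<or> S = Suc 0 \<and> b t = 1 \<and> t = n" for S
    by (auto simp: mu_step_def)
  with Suc show ?case
    by (auto simp: less_Suc_eq mu_search_running)
qed simp

text \<open>The final \<open>- 1\<close> in \<open>bev\<close> sends the states failed and running
  to \<open>0\<close> and found \<open>n\<close> to the shifted value \<open>Suc n\<close>. The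
  bound also limits the length of a search, hence \<open>n < t\<close>.\<close>

lemma bev_RMu:
  "bev t f (RMu g) xs = Suc n \<longleftrightarrow>
     n < t \<and> bev t f g (n # xs) = 1 \<and> (\<forall>m<n. bev t f g (m # xs) \<ge> 2)"
proof -
  have "bev t f (RMu g) xs = Suc n \<longleftrightarrow>
      rec_nat (Suc 0) (mu_step (\<lambda>j. bev t f g (j # xs))) t = Suc (Suc n)"
    by auto
  then show ?thesis
    unfolding mu_search_found .
qed

lemma bev_sound: "bev t f c xs = Suc v \<Longrightarrow> eval f c xs v"
proof (induction c arbitrary: xs v)
  case RZero
  then show ?case by (auto intro: eval.zero)
next
  case RSuc
  then show ?case by (cases xs) (auto intro: eval.suc)
next
  case (RProj i)
  then show ?case by (auto split: if_splits intro: eval.proj)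
next
  case (RComp g hs)
  have nz: "\<forall>h\<in>set hs. bev t f h xs \<noteq> 0"
    and g: "bev t f g (map (\<lambda>h. bev t f h xs - 1) hs) = Suc v"
    using RComp.prems by (auto split: if_splits)
  have "eval f h xs (bev t f h xs - 1)" if "h \<in> set hs" for h
    by (rule RComp.IH(2)[OF that]) (use nz that in auto)
  then have "list_all2 (\<lambda>h w. eval f h xs w) hs (map (\<lambda>h. bev t f h xs - 1) hs)"
    by (simp add: list_all2_conv_all_nth)
  then show ?case
    using RComp.IH(1)[OF g] eval.comp by blast
next
  case (RPrim g h)
  then obtain n ys where xs: "xs = n # ys"
    by (cases xs) auto
  have "rec_nat (bev t f g ys) (\<lambda>m u. if u = 0 then 0 else bev t f h (m # (u - 1) # ys)) n = Suc v
      \<Longrightarrow> eval f (RPrim g h) (n # ys) v"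
  proof (induction n arbitrary: v)
    case 0
    then show ?case by (auto intro: eval.prim0 RPrim.IH)
  next
    case (Suc n)
    let ?R = "rec_nat (bev t f g ys) (\<lambda>m u. if u = 0 then 0 else bev t f h (m # (u - 1) # ys)) n"
    from Suc.prems obtain u where u: "?R = Suc u"
      by (cases ?R) auto
    with Suc.prems have "bev t f h (n # u # ys) = Suc v"
      by simp
    then show ?case
      using Suc.IH[OF u] RPrim.IH(2) eval.primS by blast
  qed
  then show ?case
    using RPrim.prems xs by simp
next
  case (RMu g)
  then have h: "bev t f g (v # xs) = Suc 0" "\<forall>m<v. bev t f g (m # xs) \<ge> 2"
    using bev_RMu by auto
  have "\<exists>w. eval f g (m # xs) (Suc w)" if "m < v" for m
  proof -
    have "bev t f g (m # xs) \<ge> 2"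
      using h that by blast
    then obtain w where "bev t f g (m # xs) = Suc (Suc w)"
      by (metis add_2_eq_Suc le_Suc_ex)
    then show ?thesis
      using RMu.IH by blast
  qed
  then show ?case
    using RMu.IH h(1) eval.mu by blast
next
  case ROracle
  then show ?case by (cases xs) (auto split: if_splits intro: eval.orc)
qed

text \<open>Queries at or above \<open>t\<close> yield \<open>0\<close>, so a positive value has
  read the oracle only below \<open>t\<close>. One induction gives both persistence for larger
  bounds and the finite use principle.\<close>

lemma bev_mono:
  assumes "t \<le> t'" and agree: "\<And>i. i < t \<Longrightarrow> f i = f' i"
  shows "bev t f c xs = Suc v \<Longrightarrow> bev t' f' c xs = Suc v"
proof (induction c arbitrary: xs v)
  case (RComp g hs)
  have nz: "\<forall>h\<in>set hs. bev t f h xs \<noteq> 0"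
    and g: "bev t f g (map (\<lambda>h. bev t f h xs - 1) hs) = Suc v"
    using RComp.prems by (auto split: if_splits)
  have "bev t' f' h xs = bev t f h xs" if "h \<in> set hs" for h
    using RComp.IH(2)[OF that, of xs] nz that by (metis not0_implies_Suc)
  then show ?case
    using nz RComp.IH(1)[OF g] by (auto cong: map_cong)
next
  case (RPrim g h)
  then obtain n ys where xs: "xs = n # ys"
    by (cases xs) auto
  have "rec_nat (bev t f g ys) (\<lambda>m u. if u = 0 then 0 else bev t f h (m # (u - 1) # ys)) n = Suc v
      \<Longrightarrow> rec_nat (bev t' f' g ys) (\<lambda>m u. if u = 0 then 0 else bev t' f' h (m # (u - 1) # ys)) n
        = Suc v"
  proof (induction n arbitrary: v)
    case (Suc n)
    let ?R = "rec_nat (bev t f g ys) (\<lambda>m u. if u = 0 then 0 else bev t f h (m # (u - 1) # ys)) n"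
    from Suc.prems obtain u where u: "?R = Suc u"
      by (cases ?R) auto
    with Suc.prems have "bev t f h (n # u # ys) = Suc v"
      by simp
    then show ?case
      using Suc.IH[OF u] RPrim.IH(2) by simp
  qed (auto intro: RPrim.IH)
  then show ?case
    using RPrim.prems xs by simp
next
  case (RMu g)
  have "bev t' f' g (m # xs) \<ge> 2" if "bev t f g (m # xs) \<ge> 2" for m
    using RMu.IH[of "m # xs"] that by (cases "bev t f g (m # xs)") auto
  then show ?case
    using RMu.prems RMu.IH[of "v # xs" 0] assms(1) unfolding bev_RMu by auto
next
  case ROracle
  then show ?case
    using assms(1) agree by (cases xs) (auto split: if_splits)
qed (auto split: if_splits)

lemma eventually_uniform_less:
  fixes P :: "nat \<Rightarrow> nat \<Rightarrow> bool"
  assumes "\<And>m. m < n \<Longrightarrow> \<exists>t. \<forall>t'\<ge>t. P m t'"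
  shows "\<exists>t. \<forall>m<n. \<forall>t'\<ge>t. P m t'"
  using assms
proof (induction n)
  case (Suc n)
  have "\<exists>t. \<forall>m<n. \<forall>t'\<ge>t. P m t'"
    by (rule Suc.IH) (simp add: Suc.prems)
  then obtain t where "\<forall>m<n. \<forall>t''\<ge>t. P m t''" ..
  moreover obtain t' where "\<forall>t''\<ge>t'. P n t''"
    using Suc.prems[of n] by blast
  ultimately have "\<forall>m<Suc n. \<forall>t''\<ge>max t t'. P m t''"
    by (auto simp: less_Suc_eq)
  then show ?case ..
qed simp

text \<open>Asserting the value for all large bounds lets the bounds of finitely many
  subcomputations be merged by \<open>max\<close>.\<close>

lemma bev_complete: "eval f c xs v \<Longrightarrow> \<exists>t. \<forall>t'\<ge>t. bev t' f c xs = Suc v"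
proof (induction rule: eval.induct)
  case (orc x xs)
  then show ?case by (auto intro!: exI[of _ "Suc x"])
next
  case (comp xs hs ws g v)
  have len: "length hs = length ws"
    using comp by (simp add: list_all2_lengthD)
  have "\<exists>t. \<forall>m<length hs. \<forall>t'\<ge>t. bev t' f (hs ! m) xs = Suc (ws ! m)"
    by (rule eventually_uniform_less) (use comp(1) in \<open>auto simp: list_all2_conv_all_nth\<close>)
  then obtain t1 where t1: "\<And>m t'. m < length hs \<Longrightarrow> t' \<ge> t1 \<Longrightarrow> bev t' f (hs ! m) xs = Suc (ws ! m)"
    by blast
  from comp obtain t2 where t2: "\<And>t'. t' \<ge> t2 \<Longrightarrow> bev t' f g ws = Suc v"
    by blast
  have "bev t' f (RComp g hs) xs = Suc v" if "t' \<ge> max t1 t2" for t'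
  proof -
    have "map (\<lambda>h. bev t' f h xs - 1) hs = ws"
      using t1 that len by (intro nth_equalityI) auto
    moreover have "\<forall>h\<in>set hs. bev t' f h xs \<noteq> 0"
      using t1 that by (auto simp: in_set_conv_nth)
    ultimately show ?thesis
      using t2 that by auto
  qed
  then show ?case by blast
next
  case (primS g h n xs u v)
  then obtain t1 t2 where
    t1: "\<And>t'. t' \<ge> t1 \<Longrightarrow> bev t' f (RPrim g h) (n # xs) = Suc u" and
    t2: "\<And>t'. t' \<ge> t2 \<Longrightarrow> bev t' f h (n # u # xs) = Suc v"
    by blast
  have "bev t' f (RPrim g h) (Suc n # xs) = Suc v" if "t' \<ge> max t1 t2" for t'
    using t1[of t'] t2[of t'] that by simp
  then show ?case by blast
next
  case (mu g n xs)
  have "\<exists>t. \<forall>m<n. \<forall>t'\<ge>t. bev t' f g (m # xs) \<ge> 2"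
    by (rule eventually_uniform_less) (use mu(3) in fastforce)
  then obtain t1 where t1: "\<And>m t'. m < n \<Longrightarrow> t' \<ge> t1 \<Longrightarrow> bev t' f g (m # xs) \<ge> 2"
    by blast
  from mu obtain t2 where t2: "\<And>t'. t' \<ge> t2 \<Longrightarrow> bev t' f g (n # xs) = Suc 0"
    by blast
  have "bev t' f (RMu g) xs = Suc n" if "t' \<ge> max (Suc n) (max t1 t2)" for t'
    using t1[of _ t'] t2[of t'] that unfolding bev_RMu by auto
  then show ?case by blast
next
  case (prim0 g xs v h)
  then show ?case by simp
qed auto

lemma eval_iff_bev: "eval f c xs v \<longleftrightarrow> (\<exists>t. bev t f c xs = Suc v)"
  using bev_sound bev_complete by blast

lemma halts_iff_bev: "halts f c xs \<longleftrightarrow> (\<exists>t. bev t f c xs \<noteq> 0)"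
  unfolding halts_def eval_iff_bev by (metis not0_implies_Suc nat.distinct(1))

lemma eval_deterministic:
  assumes "eval f c xs v" "eval f c xs w"
  shows "v = w"
proof -
  obtain t t' where "\<forall>t''\<ge>t. bev t'' f c xs = Suc v" "\<forall>t''\<ge>t'. bev t'' f c xs = Suc w"
    using assms bev_complete by blast
  then have "Suc v = Suc w"
    by (metis max.cobounded1 max.cobounded2)
  then show ?thesis by simp
qed

lemma bev_cong:
  assumes "\<And>i. i < t \<Longrightarrow> f i = f' i"
  shows "bev t f c xs = bev t f' c xs"
proof -
  have "bev t f c xs = Suc v \<longleftrightarrow> bev t f' c xs = Suc v" for v
    using bev_mono[of t t f f' c xs v] bev_mono[of t t f' f c xs v] assms by auto
  then show ?thesis
    by (metis not0_implies_Suc)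
qed

text \<open>Totality is required only for oracles in \<open>D\<close>: decoding a function from its graph needs a search
  that terminates on graphs only. Below, binders shift the argument list by one, so that \<open>hd xs\<close> and
  \<open>tl xs\<close> are the bound variable and the outer context.\<close>

definition recf :: "(nat \<Rightarrow> nat) set \<Rightarrow> nat \<Rightarrow> ((nat \<Rightarrow> nat) \<Rightarrow> nat list \<Rightarrow> nat) \<Rightarrow> bool" where
  "recf D k F \<longleftrightarrow> (\<exists>c. \<forall>f\<in>D. \<forall>xs. length xs = k \<longrightarrow> eval f c xs (F f xs))"

lemma recf_cong:
  assumes "recf D k F" "\<And>f xs. f \<in> D \<Longrightarrow> length xs = k \<Longrightarrow> G f xs = F f xs"
  shows "recf D k G"
  using assms unfolding recf_def by fastforce

lemma recf_nth: "i < k \<Longrightarrow> recf D k (\<lambda>f xs. xs ! i)"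
  unfolding recf_def by (intro exI[of _ "RProj i"]) (auto intro: eval.proj)

lemma recf_subst:
  assumes F: "recf D (length as) F"
    and as: "\<And>a. a \<in> set as \<Longrightarrow> recf D k a"
    and G: "\<And>f xs. f \<in> D \<Longrightarrow> length xs = k \<Longrightarrow> G f xs = F f (map (\<lambda>a. a f xs) as)"
  shows "recf D k G"
proof -
  obtain c where c: "\<And>f xs. f \<in> D \<Longrightarrow> length xs = length as \<Longrightarrow> eval f c xs (F f xs)"
    using F unfolding recf_def by blast
  have "\<forall>a\<in>set as. \<exists>c. \<forall>f\<in>D. \<forall>xs. length xs = k \<longrightarrow> eval f c xs (a f xs)"
    using as unfolding recf_def by blast
  then obtain C where C:
    "\<And>a f xs. a \<in> set as \<Longrightarrow> f \<in> D \<Longrightarrow> length xs = k \<Longrightarrow> eval f (C a) xs (a f xs)"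
    by metis
  have "eval f (RComp c (map C as)) xs (G f xs)" if "f \<in> D" "length xs = k" for f xs
  proof -
    have "list_all2 (\<lambda>h w. eval f h xs w) (map C as) (map (\<lambda>a. a f xs) as)"
      using C that by (simp add: list_all2_conv_all_nth)
    then show ?thesis
      using c[of f "map (\<lambda>a. a f xs) as"] that G eval.comp by fastforce
  qed
  then show ?thesis
    unfolding recf_def by blast
qed

lemma recf_compose1:
  assumes "recf D 1 (\<lambda>f xs. \<phi> f (hd xs))" "recf D k a"
  shows "recf D k (\<lambda>f xs. \<phi> f (a f xs))"
  by (rule recf_subst[where as = "[a]" and F = "\<lambda>f xs. \<phi> f (hd xs)"]) (use assms in auto)

lemma recf_hd: "recf D (Suc k) (\<lambda>f xs. hd xs)"
  by (rule recf_cong[OF recf_nth[of 0]]) (auto simp: length_Suc_conv)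

lemma recf_tl:
  assumes "recf D k a"
  shows "recf D (Suc k) (\<lambda>f xs. a f (tl xs))"
  by (rule recf_subst[where as = "map (\<lambda>i f xs. xs ! i) [1..<Suc k]" and F = a])
    (use assms in \<open>auto simp del: upt_Suc intro!: recf_nth arg_cong[of _ _ "a _"] nth_equalityI simp: nth_tl\<close>)

lemmas recf_vars = recf_hd recf_tl[OF recf_hd] recf_tl[OF recf_tl[OF recf_hd]] recf_tl[OF recf_tl[OF recf_tl[OF recf_hd]]]
  recf_tl[OF recf_tl[OF recf_tl[OF recf_tl[OF recf_hd]]]]
  recf_tl[OF recf_tl[OF recf_tl[OF recf_tl[OF recf_tl[OF recf_hd]]]]]

lemma recf_Suc:
  assumes "recf D k a"
  shows "recf D k (\<lambda>f xs. Suc (a f xs))"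
proof -
  have "recf D 1 (\<lambda>f xs. Suc (hd xs))"
    unfolding recf_def by (rule exI[of _ RSuc]) (auto simp: length_Suc_conv intro: eval.suc)
  from recf_compose1[OF this assms] show ?thesis .
qed

lemma recf_oracle:
  assumes "recf D k a"
  shows "recf D k (\<lambda>f xs. f (a f xs))"
proof -
  have "recf D 1 (\<lambda>f xs. f (hd xs))"
    unfolding recf_def by (rule exI[of _ ROracle]) (auto simp: length_Suc_conv intro: eval.orc)
  from recf_compose1[OF this assms] show ?thesis .
qed

lemma recf_const: "recf D k (\<lambda>f xs. n)"
proof (induction n)
  case 0
  show ?case
    unfolding recf_def by (rule exI[of _ RZero]) (auto intro: eval.zero)
qed (rule recf_Suc)

lemma recf_rec_hd:
  assumes g: "recf D k g"
    and h: "recf D (Suc (Suc k)) (\<lambda>f xs. h f (tl (tl xs)) (hd xs) (hd (tl xs)))"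
  shows "recf D (Suc k) (\<lambda>f xs. rec_nat (g f (tl xs)) (\<lambda>m u. h f (tl xs) m u) (hd xs))"
proof -
  from g obtain cg where cg: "\<And>f xs. f \<in> D \<Longrightarrow> length xs = k \<Longrightarrow> eval f cg xs (g f xs)"
    unfolding recf_def by blast
  from h obtain ch where ch: "\<And>f xs. f \<in> D \<Longrightarrow> length xs = Suc (Suc k) \<Longrightarrow>
      eval f ch xs (h f (tl (tl xs)) (hd xs) (hd (tl xs)))"
    unfolding recf_def by blast
  define R where "R f xs = rec_nat (g f (tl xs)) (\<lambda>m u. h f (tl xs) m u) (hd xs)" for f xs
  have "eval f (RPrim cg ch) (n # xs) (R f (n # xs))" if "f \<in> D" "length xs = k" for f n xs
  proof (induction n)
    case 0
    then show ?case
      using that cg by (auto simp: R_def intro: eval.prim0)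
  next
    case (Suc n)
    then show ?case
      using ch[of f "n # R f (n # xs) # xs"] that by (auto simp: R_def intro: eval.primS)
  qed
  then have "recf D (Suc k) R"
    unfolding recf_def by (intro exI[of _ "RPrim cg ch"]) (auto simp: length_Suc_conv)
  then show ?thesis
    by (rule recf_cong) (simp add: R_def)
qed

lemma recf_rec:
  assumes a: "recf D k a" and g: "recf D k g"
    and h: "recf D (Suc (Suc k)) (\<lambda>f xs. h f (tl (tl xs)) (hd xs) (hd (tl xs)))"
  shows "recf D k (\<lambda>f xs. rec_nat (g f xs) (\<lambda>m u. h f xs m u) (a f xs))"
proof (rule recf_subst)
  \<comment> \<open>The recursion argument is put in front; the projections behind it reproduce the
    context that \<open>recf_rec_hd\<close> finds in the tail.\<close>
  let ?as = "a # map (\<lambda>i f xs. xs ! i) [0..<k]"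
  show "recf D (length ?as) (\<lambda>f xs. rec_nat (g f (tl xs)) (\<lambda>m u. h f (tl xs) m u) (hd xs))"
    using recf_rec_hd[OF g h] by simp
  show "recf D k b" if "b \<in> set ?as" for b
    using that a by (auto intro!: recf_nth)
  show "rec_nat (g f xs) (\<lambda>m u. h f xs m u) (a f xs) =
      rec_nat (g f (tl (map (\<lambda>b. b f xs) ?as))) (\<lambda>m u. h f (tl (map (\<lambda>b. b f xs) ?as)) m u)
        (hd (map (\<lambda>b. b f xs) ?as))" if "length xs = k" for f xs
  proof -
    have "tl (map (\<lambda>b. b f xs) ?as) = xs"
      using map_nth[of xs] that by (simp add: comp_def)
    then show ?thesis by simp
  qed
qed

lemma eval_RMu_Least:
  assumes c: "\<And>j. eval f c (j # xs) (b j)" and ex: "\<exists>j. b j = 0"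
  shows "eval f (RMu c) xs (LEAST j. b j = 0)"
proof (rule eval.mu)
  show "eval f c ((LEAST j. b j = 0) # xs) 0"
    using c[of "LEAST j. b j = 0"] LeastI_ex[OF ex] by simp
  show "\<forall>m<LEAST j. b j = 0. \<exists>w. eval f c (m # xs) (Suc w)"
  proof (intro allI impI)
    fix m
    assume "m < (LEAST j. b j = 0)"
    then have "b m \<noteq> 0"
      by (rule not_less_Least)
    then show "\<exists>w. eval f c (m # xs) (Suc w)"
      using c[of m] by (cases "b m") auto
  qed
qed

text \<open>Termination of the search is demanded on \<open>D\<close> alone; this makes a function
  recoverable from its graph.\<close>

lemma recf_Least:
  assumes "recf D (Suc k) (\<lambda>f xs. b f (tl xs) (hd xs))"
    and ex: "\<And>f xs. f \<in> D \<Longrightarrow> length xs = k \<Longrightarrow> \<exists>j. b f xs j = 0"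
  shows "recf D k (\<lambda>f xs. LEAST j. b f xs j = 0)"
proof -
  from assms(1) obtain c where
    c: "\<And>f xs. f \<in> D \<Longrightarrow> length xs = Suc k \<Longrightarrow> eval f c xs (b f (tl xs) (hd xs))"
    unfolding recf_def by blast
  have "eval f (RMu c) xs (LEAST j. b f xs j = 0)" if "f \<in> D" "length xs = k" for f xs
    by (rule eval_RMu_Least) (use c[of f "_ # xs"] ex that in auto)
  then show ?thesis
    unfolding recf_def by blast
qed

text \<open>The source of the codes for effective classes below: a search for a zero of a total test
  halts exactly when an existential number quantifier holds.\<close>

lemma halts_search:
  assumes "recf D (Suc k) (\<lambda>f xs. b f (tl xs) (hd xs))"
  obtains d where "\<And>f xs. f \<in> D \<Longrightarrow> length xs = k \<Longrightarrow> halts f d xs \<longleftrightarrow> (\<exists>t. b f xs t = 0)"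
proof -
  from assms(1) obtain c where
    c: "\<And>f xs. f \<in> D \<Longrightarrow> length xs = Suc k \<Longrightarrow> eval f c xs (b f (tl xs) (hd xs))"
    unfolding recf_def by blast
  have "halts f (RMu c) xs \<longleftrightarrow> (\<exists>t. b f xs t = 0)" if "f \<in> D" "length xs = k" for f xs
  proof
    have b: "eval f c (j # xs) (b f xs j)" for j
      using c[of f "j # xs"] that by simp
    {
      assume "halts f (RMu c) xs"
      then obtain v where "eval f (RMu c) xs v"
        unfolding halts_def by blast
      then have "eval f c (v # xs) 0"
        by cases
      with b[of v] show "\<exists>t. b f xs t = 0"
        using eval_deterministic by metis
    next
      assume "\<exists>t. b f xs t = 0"
      then have "eval f (RMu c) xs (LEAST j. b f xs j = 0)"
        by (rule eval_RMu_Least[OF b])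
      then show "halts f (RMu c) xs"
        unfolding halts_def by blast
    }
  qed
  then show ?thesis
    using that by blast
qed

subsection \<open>Arithmetic and bounded quantifiers\<close>

lemma recf_pred: "recf D k a \<Longrightarrow> recf D k (\<lambda>f xs. a f xs - 1)"
proof (rule recf_cong)
  assume "recf D k a"
  then show "recf D k (\<lambda>f xs. rec_nat 0 (\<lambda>m u. m) (a f xs))"
    by (intro recf_rec recf_const recf_vars)
  show "a f xs - 1 = rec_nat 0 (\<lambda>m u. m) (a f xs)" for f xs
    by (cases "a f xs") auto
qed

lemma recf_add: 
  assumes "recf D k a" "recf D k b"
  shows "recf D k (\<lambda>f xs. a f xs + b f xs)"
proof (rule recf_cong)
  show "recf D k (\<lambda>f xs. rec_nat (b f xs) (\<lambda>m u. Suc u) (a f xs))"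
    using assms by (intro recf_rec recf_Suc recf_vars)
  have "a + b = rec_nat b (\<lambda>m u. Suc u) a" for a b :: nat
    by (induction a) auto
  then show "a f xs + b f xs = rec_nat (b f xs) (\<lambda>m u. Suc u) (a f xs)" for f xs .
qed

lemma recf_diff: 
  assumes "recf D k a" "recf D k b"
  shows "recf D k (\<lambda>f xs. a f xs - b f xs)"
proof (rule recf_cong)
  show "recf D k (\<lambda>f xs. rec_nat (a f xs) (\<lambda>m u. u - 1) (b f xs))"
    using assms by (intro recf_rec recf_pred recf_vars)
  have "a - b = rec_nat a (\<lambda>m u. u - 1) b" for a b :: nat
    by (induction b) auto
  then show "a f xs - b f xs = rec_nat (a f xs) (\<lambda>m u. u - 1) (b f xs)" for f xs .
qed

lemma recf_mult: 
  assumes "recf D k a" "recf D k b"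
  shows "recf D k (\<lambda>f xs. a f xs * b f xs)"
proof (rule recf_cong)
  show "recf D k (\<lambda>f xs. rec_nat 0 (\<lambda>m u. b f xs + u) (a f xs))"
    using assms by (intro recf_rec recf_add recf_const recf_vars recf_tl[OF recf_tl])
  have "a * b = rec_nat 0 (\<lambda>m u. b + u) a" for a b :: nat
    by (induction a) auto
  then show "a f xs * b f xs = rec_nat 0 (\<lambda>m u. b f xs + u) (a f xs)" for f xs .
qed

lemma recf_power: 
  assumes "recf D k a" "recf D k b"
  shows "recf D k (\<lambda>f xs. a f xs ^ b f xs)"
proof (rule recf_cong)
  show "recf D k (\<lambda>f xs. rec_nat 1 (\<lambda>m u. a f xs * u) (b f xs))"
    using assms by (intro recf_rec recf_mult recf_const recf_vars recf_tl[OF recf_tl])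
  have "a ^ b = rec_nat 1 (\<lambda>m u. a * u) b" for a b :: nat
    by (induction b) auto
  then show "a f xs ^ b f xs = rec_nat 1 (\<lambda>m u. a f xs * u) (b f xs)" for f xs .
qed

text \<open>Truth is coded by \<open>0\<close>, the value for which \<open>RMu\<close>
  searches.\<close>

definition recp :: "(nat \<Rightarrow> nat) set \<Rightarrow> nat \<Rightarrow> ((nat \<Rightarrow> nat) \<Rightarrow> nat list \<Rightarrow> bool) \<Rightarrow> bool" where
  "recp D k P \<longleftrightarrow> recf D k (\<lambda>f xs. if P f xs then 0 else 1)"

lemma recf_if0:
  assumes "recf D k p" "recf D k a" "recf D k b"
  shows "recf D k (\<lambda>f xs. if p f xs = 0 then a f xs else b f xs)"
proof (rule recf_cong)
  show "recf D k (\<lambda>f xs. rec_nat (a f xs) (\<lambda>m u. b f xs) (p f xs))"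
    using assms by (intro recf_rec recf_tl[OF recf_tl])
  show "(if p f xs = 0 then a f xs else b f xs) = rec_nat (a f xs) (\<lambda>m u. b f xs) (p f xs)" for f xs
    by (cases "p f xs") auto
qed

lemma recf_if:
  assumes "recp D k P" "recf D k a" "recf D k b"
  shows "recf D k (\<lambda>f xs. if P f xs then a f xs else b f xs)"
  by (rule recf_cong[OF recf_if0[OF assms(1)[unfolded recp_def] assms(2,3)]]) auto

lemma recp_eq0:
  assumes "recf D k a"
  shows "recp D k (\<lambda>f xs. a f xs = 0)"
  unfolding recp_def by (intro recf_if0 recf_const assms)

lemma recp_cong:
  assumes "recp D k P" "\<And>f xs. f \<in> D \<Longrightarrow> length xs = k \<Longrightarrow> Q f xs = P f xs"
  shows "recp D k Q"
  using assms unfolding recp_def by (elim recf_cong) auto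

lemma recp_le:
  assumes "recf D k a" "recf D k b"
  shows "recp D k (\<lambda>f xs. a f xs \<le> b f xs)"
  by (rule recp_cong[OF recp_eq0[OF recf_diff[OF assms]]]) auto

lemma recp_less:
  assumes "recf D k a" "recf D k b"
  shows "recp D k (\<lambda>f xs. a f xs < b f xs)"
  by (rule recp_cong[OF recp_le[OF recf_Suc[OF assms(1)] assms(2)]]) auto

lemma recp_not:
  assumes "recp D k P"
  shows "recp D k (\<lambda>f xs. \<not> P f xs)"
  unfolding recp_def by (rule recf_cong[OF recf_if[OF assms recf_const[of D k 1] recf_const[of D k 0]]]) auto

lemma recp_conj:
  assumes "recp D k P" "recp D k Q"
  shows "recp D k (\<lambda>f xs. P f xs \<and> Q f xs)"
  unfolding recp_def 
  by (rule recf_cong[OF recf_if[OF assms(1) assms(2)[unfolded recp_def] recf_const[of D k 1]]]) auto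

lemma recp_eq:
  assumes "recf D k a" "recf D k b"
  shows "recp D k (\<lambda>f xs. a f xs = b f xs)"
  by (rule recp_cong[OF recp_conj[OF recp_le[OF assms] recp_le[OF assms(2,1)]]]) auto

text \<open>In the step of a \<open>rec_nat\<close> both the counter and the accumulated value stand
  in front of the context; a term in the counter alone must be lifted past the accumulator.\<close>

lemma recf_skip:
  assumes "recf D (Suc k) (\<lambda>f xs. b f (tl xs) (hd xs))"
  shows "recf D (Suc (Suc k)) (\<lambda>f xs. b f (tl (tl xs)) (hd xs))"
proof (rule recf_subst)
  let ?as = "(\<lambda>f xs. hd xs) # map (\<lambda>i f xs. xs ! i) [2..<Suc (Suc k)]"
  have [simp]: "length ?as = Suc k"
    by (simp del: upt_Suc)
  show "recf D (length ?as) (\<lambda>f xs. b f (tl xs) (hd xs))"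
    using assms by (simp del: upt_Suc)
  show "recf D (Suc (Suc k)) a" if "a \<in> set ?as" for a
    using that by (auto simp del: upt_Suc intro!: recf_hd recf_nth)
  have "tl (tl xs) = map ((!) xs) [2..<Suc (Suc k)]" if "length xs = Suc (Suc k)" for xs :: "nat list"
    using that by (intro nth_equalityI) (auto simp del: upt_Suc simp: nth_tl)
  then show "b f (tl (tl xs)) (hd xs) = b f (tl (map (\<lambda>a. a f xs) ?as)) (hd (map (\<lambda>a. a f xs) ?as))"
    if "length xs = Suc (Suc k)" for f xs
    using that by (simp del: upt_Suc add: comp_def)
qed

lemma recp_ball:
  assumes "recf D k a" "recp D (Suc k) (\<lambda>f xs. P f (tl xs) (hd xs))"
  shows "recp D k (\<lambda>f xs. \<forall>i<a f xs. P f xs i)"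
proof (rule recp_cong)
  let ?R = "\<lambda>f xs. rec_nat (0::nat) (\<lambda>m u. if P f xs m then u else 1)"
  have "recp D (Suc (Suc k)) (\<lambda>f xs. P f (tl (tl xs)) (hd xs))"
    using recf_skip[OF assms(2)[unfolded recp_def]] unfolding recp_def .
  then show "recp D k (\<lambda>f xs. ?R f xs (a f xs) = 0)"
    using assms(1) by (intro recp_eq0 recf_rec recf_if recf_const recf_vars)
  have "(?R f xs n = 0) = (\<forall>i<n. P f xs i)" for f xs n
    by (induction n) (auto simp: less_Suc_eq)
  then show "(\<forall>i<a f xs. P f xs i) = (?R f xs (a f xs) = 0)" for f xs
    by simp
qed

lemma recp_bex:
  assumes "recf D k a" "recp D (Suc k) (\<lambda>f xs. P f (tl xs) (hd xs))"
  shows "recp D k (\<lambda>f xs. \<exists>i<a f xs. P f xs i)"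
  using recp_not[OF recp_ball[OF assms(1) recp_not[OF assms(2)]]] by simp

lemma recf_sum:
  assumes "recf D k a" "recf D (Suc k) (\<lambda>f xs. b f (tl xs) (hd xs))"
  shows "recf D k (\<lambda>f xs. \<Sum>i<a f xs. b f xs i)"
proof (rule recf_cong)
  show "recf D k (\<lambda>f xs. rec_nat 0 (\<lambda>m u. u + b f xs m) (a f xs))"
    by (intro recf_rec assms recf_const recf_add recf_vars recf_skip)
  have "(\<Sum>i<n. b f xs i) = rec_nat 0 (\<lambda>m u. u + b f xs m) n" for f xs n
    by (induction n) auto
  then show "(\<Sum>i<a f xs. b f xs i) = rec_nat 0 (\<lambda>m u. u + b f xs m) (a f xs)" for f xs .
qed

lemma recf_div:
  assumes "recf D k a" "recf D k b"
  shows "recf D k (\<lambda>f xs. a f xs div b f xs)"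
proof (rule recf_cong)
  show "recf D k (\<lambda>f xs. if b f xs = 0 then 0
      else \<Sum>i<a f xs. if Suc i * b f xs \<le> a f xs then 1 else 0)"
    by (intro recf_if recp_eq recp_le recf_sum assms recf_const recf_mult recf_Suc recf_vars recf_tl)
  have "a div b = (\<Sum>i<a. if Suc i * b \<le> a then 1 else 0)" if "b > 0" for a b :: nat
  proof -
    have "{i. i < a \<and> Suc i * b \<le> a} = {..<a div b}"
    proof -
      have "Suc i * b \<le> a \<longleftrightarrow> i < a div b" for i
        using less_eq_div_iff_mult_less_eq[OF that, of "Suc i" a] by (simp add: Suc_le_eq)
      moreover have "i < a div b \<Longrightarrow> i < a" for i
        by (metis div_le_dividend order_less_le_trans)
      ultimately show ?thesis by blast
    qed
    then show ?thesis
      by (simp flip: sum.inter_filter)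
  qed
  then show "a f xs div b f xs = (if b f xs = 0 then 0
      else \<Sum>i<a f xs. if Suc i * b f xs \<le> a f xs then 1 else 0)" for f xs
    by simp
qed

lemma recf_mod:
  assumes "recf D k a" "recf D k b"
  shows "recf D k (\<lambda>f xs. a f xs mod b f xs)"
  by (rule recf_cong[OF recf_diff[OF assms(1) recf_mult[OF assms(2) recf_div[OF assms]]]])
    (simp add: minus_mult_div_eq_mod)

lemma recf_prod_encode:
  assumes "recf D k a" "recf D k b"
  shows "recf D k (\<lambda>f xs. prod_encode (a f xs, b f xs))"
  unfolding prod_encode_def triangle_def prod.case
  by (intro recf_add recf_div recf_mult recf_Suc recf_const assms)

lemmas recf_arith = recf_vars recf_const recf_Suc recf_oracle recf_add recf_diff recf_mult recf_power recf_div recf_mod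
  recf_sum recf_if recf_prod_encode recp_eq recp_le recp_less recp_not recp_conj recp_ball recp_bex

subsection \<open>The bounded evaluator is computable\<close>

lemma recf_drop:
  assumes "recf D k a"
  shows "recf D (m + k) (\<lambda>f xs. a f (drop m xs))"
  using assms
proof (induction m)
  case (Suc m)
  from recf_tl[OF Suc.IH[OF Suc.prems]] show ?case
    by (simp add: drop_Suc)
qed simp

lemma recf_append:
  assumes g: "recf D (length as + k) (\<lambda>f ys. G f (drop (length as) ys) (take (length as) ys))"
    and as: "\<And>a. a \<in> set as \<Longrightarrow> recf D (m + k) a"
  shows "recf D (m + k) (\<lambda>f ys. G f (drop m ys) (map (\<lambda>a. a f ys) as))"
proof (rule recf_subst)
  let ?bs = "as @ map (\<lambda>i f xs. xs ! i) [m..<m + k]"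
  have len: "length ?bs = length as + k"
    by simp
  show "recf D (length ?bs) (\<lambda>f ys. G f (drop (length as) ys) (take (length as) ys))"
    unfolding len by (rule g)
  show "recf D (m + k) b" if "b \<in> set ?bs" for b
    using that as by (auto intro!: recf_nth)
  have "drop m ys = map ((!) ys) [m..<m + k]" if "length ys = m + k" for ys :: "nat list"
    using that by (intro nth_equalityI) auto
  then show "G f (drop m ys) (map (\<lambda>a. a f ys) as) = G f
      (drop (length as) (map (\<lambda>b. b f ys) ?bs)) (take (length as) (map (\<lambda>b. b f ys) ?bs))"
    if "length ys = m + k" for f ys
    using that by (simp add: comp_def)
qed

text \<open>Induction over the fixed code builds one program per code. It simulates \<open>c\<close>
  with an oracle \<open>q\<close> and a bound \<open>T\<close> that themselves depend on
  \<open>k\<close> parameters and on the actual oracle. The number \<open>m\<close> of arguments is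
  generalized because subcodes may take a different number.\<close>

lemma recf_bev_aux:
  assumes O: "recf D (Suc k) (\<lambda>f ys. q f (tl ys) (hd ys))" and T: "recf D k T"
  shows "recf D (m + k) (\<lambda>f ys. bev (T f (drop m ys)) (q f (drop m ys)) c (take m ys))"
proof (induction c arbitrary: m)
  case RZero
  show ?case by (simp add: recf_const)
next
  case RSuc
  show ?case
  proof (cases m)
    case (Suc n)
    have "recf D (m + k) (\<lambda>f ys. Suc (Suc (hd ys)))"
      unfolding Suc by (simp add: recf_Suc recf_hd)
    then show ?thesis
      by (rule recf_cong) (auto simp: Suc length_Suc_conv)
  qed (simp add: recf_const)
next
  case (RProj i)
  show ?case
  proof (cases "i < m")
    case True
    then have "recf D (m + k) (\<lambda>f ys. Suc (ys ! i))"
      by (intro recf_Suc recf_nth) simp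
    then show ?thesis
      by (rule recf_cong) (use True in auto)
  next
    case False
    show ?thesis
      by (rule recf_cong[OF recf_const[of _ _ 0]]) (use False in auto)
  qed
next
  case ROracle
  show ?case
  proof (cases m)
    case (Suc n)
    have q: "recf D (m + k) (\<lambda>f ys. q f (drop m ys) (hd ys))"
    proof -
      have "recf D (m + k) (\<lambda>f ys. (\<lambda>f ps xs. q f ps (hd xs)) f (drop m ys) (map (\<lambda>a. a f ys) [\<lambda>f ys. hd ys]))"
      proof (rule recf_append)
        show "recf D (length [\<lambda>f ys. hd ys] + k) (\<lambda>f ys. q f (drop (length [\<lambda>f ys. hd ys]) ys) (hd (take (length [\<lambda>f ys. hd ys]) ys)))"
        proof -
          have "recf D (Suc k) (\<lambda>f ys. q f (drop 1 ys) (hd (take 1 ys)))"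
            by (rule recf_cong[OF O]) (auto simp: length_Suc_conv)
          then show ?thesis by simp
        qed
      qed (auto simp: Suc recf_hd)
      then show ?thesis by simp
    qed
    have "recf D (m + k) (\<lambda>f ys. if hd ys < T f (drop m ys) then Suc (q f (drop m ys) (hd ys)) else 0)"
      by (intro recf_if recp_less recf_Suc recf_const q recf_drop[OF T]) (simp add: Suc recf_hd)
    then show ?thesis
      by (rule recf_cong) (auto simp: Suc length_Suc_conv)
  qed (simp add: recf_const)
next
  case (RComp g hs)
  let ?b = "\<lambda>c f ys. bev (T f (drop m ys)) (q f (drop m ys)) c (take m ys)"
  have nz: "recp D (m + k) (\<lambda>f ys. \<exists>h\<in>set hs. ?b h f ys = 0)"
    using RComp.IH(2)
  proof (induction hs)
    case Nil
    show ?case unfolding recp_def by (simp add: recf_const)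
  next
    case (Cons h hs)
    have "recp D (m + k) (\<lambda>f ys. \<not> (?b h f ys \<noteq> 0 \<and> \<not> (\<exists>h\<in>set hs. ?b h f ys = 0)))"
      by (intro recp_not recp_conj recp_eq0 Cons) auto
    then show ?case by simp
  qed
  have "recf D (m + k) (\<lambda>f ys. (\<lambda>f ps xs. bev (T f ps) (q f ps) g xs) f (drop m ys)
      (map (\<lambda>a. a f ys) (map (\<lambda>h f ys. ?b h f ys - 1) hs)))"
    by (rule recf_append) (use RComp.IH(1)[of "length hs"] in \<open>auto simp del: One_nat_def intro!: recf_pred RComp.IH(2)\<close>)
  from recf_if[OF nz recf_const[of D "m + k" 0] this] show ?case
    by (simp add: comp_def cong: if_cong)
next
  case (RPrim g h)
  show ?case
  proof (cases m)
    case (Suc n)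
    let ?g = "\<lambda>f ys. bev (T f (drop n ys)) (q f (drop n ys)) g (take n ys)"
    let ?h = "\<lambda>f ys i u. bev (T f (drop n ys)) (q f (drop n ys)) h (i # u # take n ys)"
    have g: "recf D (n + k) ?g"
      by (rule RPrim.IH)
    have h: "recf D (Suc (Suc (n + k))) (\<lambda>f ys. ?h f (tl (tl ys)) (hd ys) (hd (tl ys)))"
      by (rule recf_cong[OF RPrim.IH(2)[of "Suc (Suc n)", simplified]]) (auto simp: length_Suc_conv)
    \<comment> \<open>Accumulated values are shifted by one; this substitution applies the
      predecessor before the step function sees them.\<close>
    let ?as = "[\<lambda>f ys. hd ys, \<lambda>f ys. hd (tl ys) - 1] @ map (\<lambda>i f xs. xs ! i) [2..<Suc (Suc (n + k))]"
    have las: "length ?as = Suc (Suc (n + k))"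
      by (simp del: upt_Suc)
    have h': "recf D (Suc (Suc (n + k))) (\<lambda>f ys. ?h f (tl (tl ys)) (hd ys) (hd (tl ys) - 1))"
    proof (rule recf_subst[where as = ?as])
      show "recf D (length ?as) (\<lambda>f ys. ?h f (tl (tl ys)) (hd ys) (hd (tl ys)))"
        unfolding las by (rule h)
      show "recf D (Suc (Suc (n + k))) a" if "a \<in> set ?as" for a
        using that by (auto simp del: upt_Suc One_nat_def intro!: recf_vars recf_nth recf_pred)
      have "tl (tl ys) = map ((!) ys) [2..<Suc (Suc (n + k))]" if "length ys = Suc (Suc (n + k))"
        for ys :: "nat list"
        using that by (intro nth_equalityI) (auto simp del: upt_Suc simp: nth_tl)
      then show "?h f (tl (tl ys)) (hd ys) (hd (tl ys) - 1) = ?h f (tl (tl (map (\<lambda>a. a f ys) ?as)))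
          (hd (map (\<lambda>a. a f ys) ?as)) (hd (tl (map (\<lambda>a. a f ys) ?as)))"
        if "length ys = Suc (Suc (n + k))" for f ys
        using that by (simp del: upt_Suc add: comp_def)
    qed
    have "recf D (Suc (n + k)) (\<lambda>f ys. rec_nat (?g f (tl ys))
        (\<lambda>i u. (\<lambda>f ys i u. if u = 0 then 0 else ?h f ys i (u - 1)) f (tl ys) i u) (hd ys))"
      by (rule recf_rec_hd[OF g]) (intro recf_if recp_eq0 recf_const h' recf_vars)
    then show ?thesis
      unfolding Suc add_Suc by (rule recf_cong) (auto simp: length_Suc_conv cong: if_cong)
  next
    case 0
    then show ?thesis by (simp add: recf_const)
  qed
next
  case (RMu g)
  let ?g = "\<lambda>f ys j. bev (T f (drop m ys)) (q f (drop m ys)) g (j # take m ys)"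
  have "recf D (Suc (m + k)) (\<lambda>f ys. ?g f (tl ys) (hd ys))"
    by (rule recf_cong[OF RMu.IH[of "Suc m", simplified]]) (auto simp: length_Suc_conv)
  then have g: "recf D (Suc (Suc (m + k))) (\<lambda>f ys. ?g f (tl (tl ys)) (hd ys))"
    by (rule recf_skip)
  have "recf D (m + k) (\<lambda>f ys. rec_nat 1 (\<lambda>j u. mu_step (?g f ys) j u) (T f (drop m ys)) - 1)"
    unfolding mu_step_def
    by (intro recf_pred recf_rec recf_if recp_eq recf_add g recf_drop[OF T] recf_const recf_vars)
  then show ?case by simp
qed

lemma recf_bev:
  assumes q: "recf D (Suc k) (\<lambda>f ys. q f (tl ys) (hd ys))" and T: "recf D k T" and a: "recf D k a"
  shows "recf D k (\<lambda>f ys. bev (T f ys) (q f ys) c [a f ys])"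
proof -
  have "recf D (0 + k) (\<lambda>f ys. bev (T f (drop 0 ys)) (q f (drop 0 ys)) c (map (\<lambda>a. a f ys) [a]))"
    by (rule recf_append) (use recf_bev_aux[OF q T, of "Suc 0" c] a in auto)
  then show ?thesis by simp
qed

subsection \<open>Graphs and finite modifications\<close>

text \<open>Since \<open>i \<le> prod_encode (i, j)\<close>, the bounded quantifier loses no pair.
  It makes the graph decidable in \<open>g\<close>, with membership of \<open>n\<close> depending
  only on the values of \<open>g\<close> up to \<open>n\<close>.\<close>

definition graph :: "(nat \<Rightarrow> nat) \<Rightarrow> cantor" where
  "graph g n \<longleftrightarrow> (\<exists>i<Suc n. prod_encode (i, g i) = n)"

lemma graph_prod_encode: "graph g (prod_encode (i, j)) \<longleftrightarrow> g i = j"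
  using le_prod_encode_1[of i j] by (auto simp: graph_def less_Suc_eq_le)

lemma b2n_graph: "b2n (graph g) n = (if \<exists>i<Suc n. prod_encode (i, g i) = n then 1 else 0)"
  by (simp add: b2n_def graph_def)

text \<open>Finite sequences are coded by digits in a base, so that decoding takes only
  \<open>div\<close>, \<open>mod\<close> and powers.\<close>

lemma digits_exist:
  fixes B :: nat
  assumes "\<And>i. i < t \<Longrightarrow> a i < B"
  shows "\<exists>p<B ^ t. \<forall>i<t. p div B ^ i mod B = a i"
  using assms
proof (induction t arbitrary: a)
  case (Suc t)
  have "\<exists>p<B ^ t. \<forall>i<t. p div B ^ i mod B = a (Suc i)"
    by (rule Suc.IH) (simp add: Suc.prems)
  then obtain p where p: "p < B ^ t" "\<And>i. i < t \<Longrightarrow> p div B ^ i mod B = a (Suc i)"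
    by blast
  have a0: "a 0 < B"
    using Suc.prems by simp
  have "a 0 + B * p < B ^ Suc t"
  proof -
    have "a 0 + B * p < B * Suc p"
      using a0 by simp
    also have "\<dots> \<le> B * B ^ t"
      using p(1) by (intro mult_le_mono2) simp
    finally show ?thesis by simp
  qed
  moreover have "(a 0 + B * p) div B ^ i mod B = a i" if "i < Suc t" for i
  proof (cases i)
    case 0
    then show ?thesis using a0 by simp
  next
    case (Suc j)
    then have "(a 0 + B * p) div B ^ i = (a 0 + B * p) div B div B ^ j"
      by (simp add: div_mult2_eq)
    also have "(a 0 + B * p) div B = p"
      using a0 by simp
    finally show ?thesis
      using p(2) Suc that by simp
  qed
  ultimately show ?case by blast
qed simp

text \<open>Dependent choice along finite lists, glued to one function. It serves the compactness
  argument of \<open>bounded_sequence_limit\<close> and the choice of bounds in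
  \<open>large_bounded_section\<close>.\<close>

lemma prefix_choice:
  assumes "P []" and "\<And>xs. P xs \<Longrightarrow> \<exists>j. P (xs @ [j])"
  obtains h :: "nat \<Rightarrow> 'a" where "\<And>n. P (map h [0..<n])"
proof -
  have "\<exists>X. \<forall>n. (P (X n) \<and> length (X n) = n) \<and> (\<exists>j. X (Suc n) = X n @ [j])"
    by (rule dependent_nat_choice) (use assms in fastforce)+
  then obtain X where
    *: "\<forall>n. (P (X n) \<and> length (X n) = n) \<and> (\<exists>j. X (Suc n) = X n @ [j])" ..
  define h where "h i = X (Suc i) ! i" for i
  have "X n = map h [0..<n]" for n
  proof (induction n)
    case 0
    then show ?case
      using * by (metis length_0_conv list.simps(8) upt_0)
  next
    case (Suc n)
    obtain j where "X (Suc n) = X n @ [j]" "length (X n) = n"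
      using * by blast
    then show ?case
      using Suc by (simp add: h_def nth_append)
  qed
  then show ?thesis
    using that * by metis
qed

text \<open>Koenig's lemma as sequential compactness: infinitely many indices agree with the prefix
  built so far, and the pigeonhole principle on the bounded next value preserves this.\<close>

lemma bounded_sequence_limit:
  fixes F :: "nat \<Rightarrow> nat \<Rightarrow> nat"
  assumes bound: "\<And>k i. i < k \<Longrightarrow> F k i \<le> G i"
  obtains h where "\<And>i. h i \<le> G i" and "\<And>n. \<exists>k\<ge>n. \<forall>i<n. F k i = h i"
proof -
  let ?K = "\<lambda>xs. {k. \<forall>i<length xs. F k i = xs ! i}"
  obtain h where h: "\<And>n. infinite (?K (map h [0..<n]))"
  proof (rule prefix_choice[where P = "\<lambda>xs. infinite (?K xs)"])
    show "\<exists>j. infinite (?K (xs @ [j]))" if inf: "infinite (?K xs)" for xs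
    proof -
      let ?n = "length xs"
      \<comment> \<open>The bound at position \<open>?n\<close> is available only for indices above
        \<open>?n\<close>; the finitely many others are discarded.\<close>
      have "infinite (?K xs - {..?n})"
        using inf by simp
      moreover have "finite ((\<lambda>k. F k ?n) ` (?K xs - {..?n}))"
        by (rule finite_subset[of _ "{..G ?n}"]) (auto intro: bound)
      ultimately obtain k0 where
        "infinite {k \<in> ?K xs - {..?n}. F k ?n = F k0 ?n}"
        using pigeonhole_infinite[of "?K xs - {..?n}" "\<lambda>k. F k ?n"] by blast
      moreover have "{k \<in> ?K xs - {..?n}. F k ?n = F k0 ?n} \<subseteq> ?K (xs @ [F k0 ?n])"
        by (auto simp: nth_append less_Suc_eq)
      ultimately show ?thesis
        using finite_subset by blast
    qed
  qed auto
  have lim: "\<exists>k\<ge>n. \<forall>i<n. F k i = h i" for n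
  proof -
    obtain k where "k \<ge> n" "k \<in> ?K (map h [0..<n])"
      using h[of n] by (meson infinite_nat_iff_unbounded_le)
    then show ?thesis
      by auto
  qed
  moreover have "h i \<le> G i" for i
    using lim[of "Suc i"] bound by (metis Suc_le_lessD lessI)
  ultimately show ?thesis
    using that by blast
qed

lemma ojoin_cong:
  assumes "\<And>i. i < t \<Longrightarrow> h i = h' i" "j < t"
  shows "ojoin f h j = ojoin f h' j"
  using assms(1)[of "j div 2"] assms(2) by (auto simp: ojoin_def)

lemma graph_cong:
  assumes "\<And>i. i < t \<Longrightarrow> g i = g' i" "n < t"
  shows "b2n (graph g) n = b2n (graph g') n"
proof -
  have "g i = g' i" if "i < Suc n" for i
    using assms that by simp
  then have "(\<exists>i<Suc n. prod_encode (i, g i) = n) = (\<exists>i<Suc n. prod_encode (i, g' i) = n)"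
    by metis
  then show ?thesis
    unfolding b2n_graph by simp
qed

subsection \<open>Compact sections\<close>

definition bounded_section :: "rcode \<Rightarrow> (nat \<Rightarrow> nat) \<Rightarrow> cantor set" where
  "bounded_section c G = {z. \<exists>h. (\<forall>i. h i \<le> G i) \<and> \<not> halts (ojoin (b2n z) h) c [0]}"

text \<open>By compactness, the quantifier over all \<open>h\<close> below \<open>G\<close> becomes
  a bounded one over digit codes \<open>p\<close> at some level \<open>t\<close>. The base exceeds
  \<open>G i\<close> for every \<open>i < t\<close>, so each such \<open>h\<close> has a code below
  \<open>t\<close>; \<open>min\<close> tames the codes of other sequences.\<close>

lemma bounded_section_complement:
  fixes q :: "nat \<Rightarrow> nat \<Rightarrow> nat \<Rightarrow> nat"
  assumes q: "\<And>t p i. q t p i = min (G i) (p div Suc (\<Sum>i<t. G i) ^ i mod Suc (\<Sum>i<t. G i))"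
  shows "z \<notin> bounded_section c G \<longleftrightarrow>
    (\<exists>t. \<forall>p<Suc (\<Sum>i<t. G i) ^ t. bev t (ojoin (b2n z) (q t p)) c [0] \<noteq> 0)"
proof
  assume z: "z \<notin> bounded_section c G"
  show "\<exists>t. \<forall>p<Suc (\<Sum>i<t. G i) ^ t. bev t (ojoin (b2n z) (q t p)) c [0] \<noteq> 0"
  proof (rule ccontr)
    assume "\<nexists>t. \<forall>p<Suc (\<Sum>i<t. G i) ^ t. bev t (ojoin (b2n z) (q t p)) c [0] \<noteq> 0"
    then obtain p where p: "\<And>t. bev t (ojoin (b2n z) (q t (p t))) c [0] = 0"
      by metis
    \<comment> \<open>Unrefuted candidates at all levels accumulate at some \<open>h\<close> below
      \<open>G\<close>; a halting computation with \<open>h\<close> would already occur with a late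
      candidate.\<close>
    obtain h where h: "\<And>i. h i \<le> G i" "\<And>n. \<exists>k\<ge>n. \<forall>i<n. q k (p k) i = h i"
      by (rule bounded_sequence_limit[of "\<lambda>k. q k (p k)" G]) (auto simp: q)
    with z have "halts (ojoin (b2n z) h) c [0]"
      unfolding bounded_section_def by blast
    then obtain t v where t: "bev t (ojoin (b2n z) h) c [0] = Suc v"
      unfolding halts_iff_bev by (metis not0_implies_Suc)
    from h(2)[of t] obtain k where k: "k \<ge> t" "\<And>i. i < t \<Longrightarrow> q k (p k) i = h i"
      by blast
    have "bev k (ojoin (b2n z) (q k (p k))) c [0] = Suc v"
      by (rule bev_mono[OF k(1) _ t]) (use k(2) in \<open>metis ojoin_cong\<close>)
    with p show False by simp
  qed
next
  assume "\<exists>t. \<forall>p<Suc (\<Sum>i<t. G i) ^ t. bev t (ojoin (b2n z) (q t p)) c [0] \<noteq> 0"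
  then obtain t where t: "\<And>p. p < Suc (\<Sum>i<t. G i) ^ t \<Longrightarrow> bev t (ojoin (b2n z) (q t p)) c [0] \<noteq> 0"
    by blast
  have "halts (ojoin (b2n z) h) c [0]" if h: "\<And>i. h i \<le> G i" for h
  proof -
    have "h i < Suc (\<Sum>i<t. G i)" if "i < t" for i
      using h[of i] member_le_sum[of i "{..<t}" G] that by (simp add: less_Suc_eq_le)
    then obtain p where p: "p < Suc (\<Sum>i<t. G i) ^ t"
      "\<And>i. i < t \<Longrightarrow> p div Suc (\<Sum>i<t. G i) ^ i mod Suc (\<Sum>i<t. G i) = h i"
      using digits_exist[of t h "Suc (\<Sum>i<t. G i)"] by blast
    have "bev t (ojoin (b2n z) h) c [0] = bev t (ojoin (b2n z) (q t p)) c [0]"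
      by (rule bev_cong, rule ojoin_cong) (use p(2) h in \<open>auto simp: q\<close>)
    then show ?thesis
      unfolding halts_iff_bev using t[OF p(1)] by metis
  qed
  then show "z \<notin> bounded_section c G"
    unfolding bounded_section_def by blast
qed

lemma pi01_bounded_section: "pi01_rel (graph G) (bounded_section c G)"
proof -
  let ?D = "range (\<lambda>z. ojoin (b2n (graph G)) (b2n z))"
  \<comment> \<open>Even positions of the join hold the graph of \<open>G\<close>, whence the factor
    2; the difference vanishes exactly when the pair lies in the graph.\<close>
  define Gf where "Gf f i = (LEAST j. 1 - f (2 * prod_encode (i, j)) = (0 :: nat))"
    for f :: "nat \<Rightarrow> nat" and i
  have val: "f (2 * prod_encode (i, j)) = (if G i = j then 1 else 0)" if "f \<in> ?D" for f i j
    using that by (auto simp: ojoin_def b2n_def graph_prod_encode)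
  have recG: "recf ?D k (\<lambda>f xs. Gf f (a f xs))" if "recf ?D k a" for k a
    unfolding Gf_def
  proof (rule recf_Least)
    show "recf ?D (Suc k) (\<lambda>f xs. 1 - f (2 * prod_encode (a f (tl xs), hd xs)))"
      by (intro recf_arith recf_tl that)
    show "\<exists>j. 1 - f (2 * prod_encode (a f xs, j)) = 0" if "f \<in> ?D" for f xs
      using val[OF that] by auto
  qed
  have Gf: "Gf f = G" if "f \<in> ?D" for f
    using val[OF that] by (auto simp: Gf_def fun_eq_iff intro!: Least_equality split: if_splits)
  define dig where "dig f t p i = p div Suc (\<Sum>i<t. Gf f i) ^ i mod Suc (\<Sum>i<t. Gf f i)" for f t p i
  define q where "q f t p i = (if dig f t p i \<le> Gf f i then dig f t p i else Gf f i)" for f t p i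
  \<comment> \<open>The code \<open>c\<close> expects \<open>z\<close> at even positions and the
    candidate at odd ones, while the given oracle carries \<open>z\<close> at its odd
    positions.\<close>
  define Q where "Q f t p i =
      (if i mod 2 = 0 then f (2 * (i div 2) + 1) else q f t p (i div 2))" for f t p i
  have "recp ?D (Suc (Suc 0)) (\<lambda>f xs. \<forall>p<Suc (\<Sum>i<hd xs. Gf f i) ^ hd xs.
      \<not> bev (hd xs) (Q f (hd xs) p) c [0] = 0)"
    unfolding Q_def q_def dig_def by (intro recf_arith recf_bev recG)
  then have "recf ?D (Suc (Suc 0)) (\<lambda>f xs. (\<lambda>f ys t. if \<forall>p<Suc (\<Sum>i<t. Gf f i) ^ t.
      \<not> bev t (Q f t p) c [0] = 0 then 0 else 1) f (tl xs) (hd xs))"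
    unfolding recp_def by simp
  then obtain d where d: "\<And>f xs. f \<in> ?D \<Longrightarrow> length xs = Suc 0 \<Longrightarrow> halts f d xs \<longleftrightarrow>
      (\<exists>t. (if \<forall>p<Suc (\<Sum>i<t. Gf f i) ^ t. \<not> bev t (Q f t p) c [0] = 0 then 0 else 1) = (0::nat))"
    by (rule halts_search) blast
  have "z \<in> bounded_section c G \<longleftrightarrow> \<not> halts (ojoin (b2n (graph G)) (b2n z)) d [0]" for z
  proof -
    let ?f = "ojoin (b2n (graph G)) (b2n z)"
    have G: "Gf ?f = G"
      by (rule Gf) simp
    have Q: "Q ?f t p = ojoin (b2n z) (q ?f t p)" for t p
      by (auto simp: Q_def ojoin_def fun_eq_iff even_iff_mod_2_eq_zero)
    have "halts ?f d [0] \<longleftrightarrow>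
        (\<exists>t. \<forall>p<Suc (\<Sum>i<t. G i) ^ t. bev t (ojoin (b2n z) (q ?f t p)) c [0] \<noteq> 0)"
      by (subst d) (simp_all add: G Q)
    also have "\<dots> \<longleftrightarrow> z \<notin> bounded_section c G"
      by (rule bounded_section_complement[symmetric]) (simp add: q_def dig_def G)
    finally show ?thesis by simp
  qed
  then show ?thesis
    unfolding pi01_rel_def by blast
qed

subsection \<open>A normal form for values forced by large functions\<close>

text \<open>A computation with a value other than \<open>v\<close> reads \<open>g\<close> only below
  its bound, so \<open>g\<close> may be replaced by the stem followed by \<open>h\<close> plus the
  base-\<open>B\<close> digits of a number \<open>p\<close>. The universal quantifier over
  \<open>g\<close> becomes the failure of a search over numbers, which is the non-halting that
  \<open>sigma11_nat\<close> asks for.\<close>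

lemma sigma11_forced_value:
  "sigma11_nat {n. \<exists>h. \<forall>g. (\<forall>i<l. g i = s i) \<longrightarrow> (\<forall>i\<ge>l. h i \<le> g i) \<longrightarrow>
      (\<forall>w. eval (b2n (graph g)) c [n] w \<longrightarrow> w = v)}"
proof -
  obtain p0 B0 where s0: "\<And>i. i < l \<Longrightarrow> p0 div B0 ^ i mod B0 = s i"
    using digits_exist[of l s "Suc (\<Sum>i<l. s i)"] member_le_sum[of _ "{..<l}" s]
    by (auto simp: less_Suc_eq_le)
  define g where "g f p B i = (if i < l then p0 div B0 ^ i mod B0 else f i + p div B ^ i mod B)"
    for f p B i
  have "recp UNIV (Suc (Suc 0)) (\<lambda>f xs. \<exists>a<hd xs. \<exists>p<hd xs. \<exists>B<hd xs.
      \<not> bev a (\<lambda>m. if \<exists>i<Suc m. prod_encode (i, g f p B i) = m then 1 else 0) c [hd (tl xs)] = 0 \<and>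
      \<not> bev a (\<lambda>m. if \<exists>i<Suc m. prod_encode (i, g f p B i) = m then 1 else 0) c [hd (tl xs)] = Suc v)"
    unfolding g_def by (intro recf_arith recf_bev)
  then have "recf UNIV (Suc (Suc 0)) (\<lambda>f xs. (\<lambda>f ys t. if \<exists>a<t. \<exists>p<t. \<exists>B<t.
      bev a (b2n (graph (g f p B))) c [hd ys] \<noteq> 0 \<and>
      bev a (b2n (graph (g f p B))) c [hd ys] \<noteq> Suc v then 0 else 1) f (tl xs) (hd xs))"
    unfolding recp_def b2n_graph[abs_def] by simp
  then obtain d where d: "\<And>f xs. f \<in> UNIV \<Longrightarrow> length xs = Suc 0 \<Longrightarrow> halts f d xs \<longleftrightarrow>
      (\<exists>t. (if \<exists>a<t. \<exists>p<t. \<exists>B<t. bev a (b2n (graph (g f p B))) c [hd xs] \<noteq> 0 \<and>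
        bev a (b2n (graph (g f p B))) c [hd xs] \<noteq> Suc v then 0 else 1) = (0::nat))"
    by (rule halts_search) blast
  have "halts h d [n] \<longleftrightarrow> (\<exists>k. (\<forall>i<l. k i = s i) \<and> (\<forall>i\<ge>l. h i \<le> k i) \<and>
      (\<exists>w. eval (b2n (graph k)) c [n] w \<and> w \<noteq> v))" (is "_ \<longleftrightarrow> ?R") for h n
  proof
    assume "halts h d [n]"
    then obtain a p B where *: "bev a (b2n (graph (g h p B))) c [n] \<noteq> 0"
        "bev a (b2n (graph (g h p B))) c [n] \<noteq> Suc v"
      by (subst (asm) d) (auto split: if_splits)
    then obtain w where "bev a (b2n (graph (g h p B))) c [n] = Suc w" "w \<noteq> v"
      by (metis not0_implies_Suc)
    then have "eval (b2n (graph (g h p B))) c [n] w \<and> w \<noteq> v"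
      using bev_sound by blast
    moreover have "(\<forall>i<l. g h p B i = s i) \<and> (\<forall>i\<ge>l. h i \<le> g h p B i)"
      by (simp add: g_def s0)
    ultimately show ?R by blast
  next
    assume ?R
    then obtain k w where k: "\<forall>i<l. k i = s i" "\<forall>i\<ge>l. h i \<le> k i"
      "eval (b2n (graph k)) c [n] w" "w \<noteq> v"
      by blast
    then obtain a where a: "bev a (b2n (graph k)) c [n] = Suc w"
      using eval_iff_bev by blast
    \<comment> \<open>Truncated subtraction is harmless: from \<open>l\<close> on
      \<open>h i \<le> k i\<close>, and below \<open>l\<close> the stem overrides the
      digits.\<close>
    obtain p B where pB: "\<And>i. i < a \<Longrightarrow> p div B ^ i mod B = k i - h i"
      using digits_exist[of a "\<lambda>i. k i - h i" "Suc (\<Sum>i<a. k i - h i)"]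
        member_le_sum[of _ "{..<a}" "\<lambda>i. k i - h i"]
      by (auto simp: less_Suc_eq_le)
    have "bev a (b2n (graph (g h p B))) c [n] = bev a (b2n (graph k)) c [n]"
      by (rule bev_cong, rule graph_cong) (use k pB s0 in \<open>auto simp: g_def\<close>)
    then have "bev a (b2n (graph (g h p B))) c [n] \<noteq> 0"
      "bev a (b2n (graph (g h p B))) c [n] \<noteq> Suc v"
      using a k(4) by auto
    moreover have "a < Suc (a + p + B)" "p < Suc (a + p + B)" "B < Suc (a + p + B)"
      by auto
    ultimately have "\<exists>t. \<exists>a<t. \<exists>p<t. \<exists>B<t. bev a (b2n (graph (g h p B))) c [n] \<noteq> 0 \<and>
        bev a (b2n (graph (g h p B))) c [n] \<noteq> Suc v"
      by blast
    then show "halts h d [n]"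
      by (subst d) auto
  qed
  then show ?thesis
    unfolding sigma11_nat_def by (intro exI[of _ d]) blast
qed

subsection \<open>Open sets and cylinders in Cantor space\<close>

definition ball_at :: "nat \<Rightarrow> cantor \<Rightarrow> cantor set" where
  "ball_at n x = {y. \<forall>i<n. y i = x i}"

definition opn :: "cantor set \<Rightarrow> bool" where
  "opn U \<longleftrightarrow> (\<forall>x\<in>U. \<exists>n. ball_at n x \<subseteq> U)"

definition sec :: "bool \<Rightarrow> cantor set \<Rightarrow> cantor set" where
  "sec b U = {x. case_nat b x \<in> U}"

lemma self_in_ball_at [simp]: "x \<in> ball_at n x"
  by (simp add: ball_at_def)

lemma ball_at_antimono: "m \<le> n \<Longrightarrow> ball_at n x \<subseteq> ball_at m x"
  by (auto simp: ball_at_def)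

lemma opn_UNIV: "opn UNIV"
  by (auto simp: opn_def)

lemma opn_Union:
  assumes "\<And>i. i \<in> I \<Longrightarrow> opn (U i)"
  shows "opn (\<Union>i\<in>I. U i)"
  unfolding opn_def
proof
  fix x
  assume "x \<in> (\<Union>i\<in>I. U i)"
  then obtain i where i: "i \<in> I" "x \<in> U i"
    by blast
  then obtain n where "ball_at n x \<subseteq> U i"
    using assms unfolding opn_def by blast
  then have "ball_at n x \<subseteq> (\<Union>i\<in>I. U i)"
    using UN_upper[OF i(1), of U] by (rule order_trans)
  then show "\<exists>n. ball_at n x \<subseteq> (\<Union>i\<in>I. U i)" ..
qed

lemma opn_Int: "opn U \<Longrightarrow> opn V \<Longrightarrow> opn (U \<inter> V)"
  unfolding opn_def
proof
  fix x
  assume "\<forall>x\<in>U. \<exists>n. ball_at n x \<subseteq> U" "\<forall>x\<in>V. \<exists>n. ball_at n x \<subseteq> V" "x \<in> U \<inter> V"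
  then obtain m n where "ball_at m x \<subseteq> U" "ball_at n x \<subseteq> V"
    by blast
  then have "ball_at (max m n) x \<subseteq> U \<inter> V"
    using ball_at_antimono[of m "max m n" x] ball_at_antimono[of n "max m n" x] by auto
  then show "\<exists>n. ball_at n x \<subseteq> U \<inter> V" ..
qed

lemma opn_ball_at: "opn (ball_at n x)"
  unfolding opn_def by (intro ballI exI[of _ n]) (auto simp: ball_at_def)

lemma ball_at_Suc_case_nat:
  "case_nat b y \<in> ball_at (Suc n) x \<longleftrightarrow> b = x 0 \<and> y \<in> ball_at n (\<lambda>i. x (Suc i))"
  by (auto simp: ball_at_def All_less_Suc2)

lemma opn_sec:
  assumes "opn U"
  shows "opn (sec b U)"
  unfolding opn_def
proof
  fix x
  assume "x \<in> sec b U"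
  then obtain n where n: "ball_at n (case_nat b x) \<subseteq> U"
    using assms unfolding opn_def sec_def by blast
  then have "ball_at (Suc n) (case_nat b x) \<subseteq> U"
    using ball_at_antimono[of n "Suc n"] by fastforce
  then have "ball_at n x \<subseteq> sec b U"
    by (auto simp: sec_def ball_at_Suc_case_nat subset_iff)
  then show "\<exists>n. ball_at n x \<subseteq> sec b U" ..
qed

lemma sec_mono: "U \<subseteq> V \<Longrightarrow> sec b U \<subseteq> sec b V"
  by (auto simp: sec_def)

lemma sec_simps [simp]:
  "sec b UNIV = UNIV" "sec b {} = {}" "sec b (U \<union> V) = sec b U \<union> sec b V"
  "sec b (U \<inter> V) = sec b U \<inter> sec b V" "sec b (\<Union>i\<in>I. W i) = (\<Union>i\<in>I. sec b (W i))"
  by (auto simp: sec_def)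

lemma cantor_compact:
  assumes opn: "\<And>n. opn (V n)" and inc: "\<And>n. V n \<subseteq> V (Suc n)" and cover: "(\<Union>n. V n) = UNIV"
  shows "\<exists>n. V n = UNIV"
proof (rule ccontr)
  assume "\<nexists>n. V n = UNIV"
  then have "\<exists>x. x \<notin> V n" for n
    by blast
  then obtain x where x: "\<And>n. x n \<notin> V n"
    by metis
  obtain h where h: "\<And>n. \<exists>k\<ge>n. \<forall>i<n. b2n (x k) i = h i"
    by (rule bounded_sequence_limit[of "\<lambda>k. b2n (x k)" "\<lambda>_. 1"]) (auto simp: b2n_def)
  define z where "z i \<longleftrightarrow> h i = 1" for i
  obtain m where "z \<in> V m"
    using cover by blast
  then obtain n where n: "ball_at n z \<subseteq> V m"
    using opn unfolding opn_def by blast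
  obtain k where k: "k \<ge> max m n" "\<And>i. i < max m n \<Longrightarrow> b2n (x k) i = h i"
    using h by blast
  have "x k i = z i" if "i < n" for i
  proof -
    have "b2n (x k) i = h i"
      using k(2) that by simp
    then show ?thesis
      by (auto simp: z_def b2n_def split: if_splits)
  qed
  then have "x k \<in> V m"
    using n by (auto simp: ball_at_def)
  then show False
    using lift_Suc_mono_le[of V m k] inc k(1) x by auto
qed

subsection \<open>The dyadic content\<close>

locale dyadic_content =
  fixes r :: real
  assumes r_ge: "1/2 \<le> r" and r_less: "r < 1"
begin

text \<open>The least cost of a cover by cylinders, relative to the current node: taking the node
  costs 1, treating its halves separately costs \<open>r\<close> times their sum. Depth
  \<open>n\<close> sees only cylinders of length \<open>n\<close> inside \<open>U\<close>, so the
  approximations come from within and increase.\<close>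

fun content_upto :: "nat \<Rightarrow> cantor set \<Rightarrow> real" where
  "content_upto 0 U = (if U = UNIV then 1 else 0)"
| "content_upto (Suc n) U = min 1 (r * (content_upto n (sec False U) + content_upto n (sec True U)))"

definition content :: "cantor set \<Rightarrow> real" where
  "content U = (SUP n. content_upto n U)"

lemma r_pos: "0 < r"
  using r_ge by simp

lemma content_upto_nonneg: "0 \<le> content_upto n U"
  by (induction n arbitrary: U) (use r_pos in auto)

lemma content_upto_le_1: "content_upto n U \<le> 1"
  by (cases n) auto

lemma content_upto_mono: "U \<subseteq> V \<Longrightarrow> content_upto n U \<le> content_upto n V"
proof (induction n arbitrary: U V)
  case (Suc n)
  have "content_upto n (sec b U) \<le> content_upto n (sec b V)" for b
    by (intro Suc.IH sec_mono Suc.prems)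
  then show ?case
    using r_pos by (simp only: content_upto.simps) (intro min.mono order_refl mult_left_mono add_mono, auto)
qed auto

lemma content_upto_UNIV: "content_upto n UNIV = 1"
proof (induction n)
  case (Suc n)
  then show ?case using r_ge by simp
qed simp

lemma content_upto_empty: "content_upto n {} = 0"
  by (induction n) auto

lemma content_upto_Suc: "content_upto n U \<le> content_upto (Suc n) U"
proof (induction n arbitrary: U)
  case 0
  then show ?case
    using content_upto_UNIV[of "Suc 0"] content_upto_nonneg[of "Suc 0" U] by (auto simp del: content_upto.simps(2))
next
  case (Suc n)
  have "content_upto (Suc n) U = min 1 (r * (content_upto n (sec False U) + content_upto n (sec True U)))"
    by simp
  also have "\<dots> \<le> min 1 (r * (content_upto (Suc n) (sec False U) + content_upto (Suc n) (sec True U)))"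
    using r_pos by (intro min.mono order_refl mult_left_mono add_mono Suc.IH) auto
  finally show ?case
    by (simp only: content_upto.simps)
qed

lemma bdd_content_upto: "bdd_above (range (\<lambda>n. content_upto n U))"
  by (rule bdd_aboveI[of _ 1]) (auto intro: content_upto_le_1)

lemma content_upto_tendsto: "(\<lambda>n. content_upto n U) \<longlonglongrightarrow> content U"
  unfolding content_def by (rule LIMSEQ_incseq_SUP[OF bdd_content_upto]) (intro incseq_SucI content_upto_Suc)

lemma content_upto_le_content: "content_upto n U \<le> content U"
  unfolding content_def by (rule cSUP_upper[OF UNIV_I bdd_content_upto])

lemma content_least: "(\<And>n. content_upto n U \<le> c) \<Longrightarrow> content U \<le> c"
  unfolding content_def by (rule cSUP_least) auto

lemma content_nonneg: "0 \<le> content U"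
  using content_upto_nonneg[of 0 U] content_upto_le_content[of 0 U] by simp

lemma content_le_1: "content U \<le> 1"
  by (intro content_least content_upto_le_1)

lemma content_mono: "U \<subseteq> V \<Longrightarrow> content U \<le> content V"
  using content_upto_mono content_upto_le_content by (intro content_least) (meson order_trans)

lemma content_UNIV: "content UNIV = 1"
  using content_upto_le_content[of 0 UNIV] content_le_1[of UNIV] by simp

lemma content_empty: "content {} = 0"
  unfolding content_def by (simp add: content_upto_empty)

lemma content_rec: "content U = min 1 (r * (content (sec False U) + content (sec True U)))"
proof (rule LIMSEQ_unique)
  show "(\<lambda>n. content_upto (Suc n) U) \<longlonglongrightarrow> content U"
    by (rule LIMSEQ_Suc[OF content_upto_tendsto])
  show "(\<lambda>n. content_upto (Suc n) U) \<longlonglongrightarrow> min 1 (r * (content (sec False U) + content (sec True U)))"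
    unfolding content_upto.simps by (intro tendsto_intros content_upto_tendsto)
qed

lemma content_ball_at: "content (ball_at n x) \<le> r ^ n"
proof (induction n arbitrary: x)
  case 0
  then show ?case
    using content_le_1 by simp
next
  case (Suc n)
  have sec: "sec b (ball_at (Suc n) x) = (if b = x 0 then ball_at n (\<lambda>i. x (Suc i)) else {})" for b
    by (auto simp: sec_def ball_at_Suc_case_nat)
  have "content (ball_at (Suc n) x) \<le> r * content (ball_at n (\<lambda>i. x (Suc i)))"
    unfolding content_rec[of "ball_at (Suc n) x"] sec by (cases "x 0") (auto simp: content_empty)
  also have "\<dots> \<le> r * r ^ n"
    using Suc r_pos by (intro mult_left_mono) auto
  finally show ?case by simp
qed

text \<open>Depth \<open>n\<close> inspects finitely many sections. At a leaf, compactness makes a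
  full union full at a finite stage, and the larger of two stages serves both halves.\<close>

lemma content_upto_Union_incseq:
  assumes "\<And>k. opn (U k)" "incseq U"
  shows "\<exists>k. content_upto n (\<Union>k. U k) \<le> content_upto n (U k)"
  using assms
proof (induction n arbitrary: U)
  case 0
  show ?case
  proof (cases "(\<Union>k. U k) = UNIV")
    case True
    then obtain k where "U k = UNIV"
      using cantor_compact[of U] 0 by (auto simp: incseq_Suc_iff)
    then show ?thesis
      by (intro exI[of _ k]) simp
  qed auto
next
  case (Suc n)
  have "\<exists>k. content_upto n (\<Union>k. sec b (U k)) \<le> content_upto n (sec b (U k))" for b
    by (rule Suc.IH) (use Suc.prems in \<open>auto intro!: opn_sec simp: mono_def sec_mono\<close>)
  then obtain k l where kl: "content_upto n (\<Union>k. sec False (U k)) \<le> content_upto n (sec False (U k))"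
    "content_upto n (\<Union>k. sec True (U k)) \<le> content_upto n (sec True (U l))"
    by metis
  have up: "content_upto n (sec b (U j)) \<le> content_upto n (sec b (U (max k l)))" if "j \<le> max k l" for b j
    using Suc.prems(2) that by (intro content_upto_mono sec_mono) (auto simp: mono_def)
  have "content_upto n (\<Union>k. sec False (U k)) \<le> content_upto n (sec False (U (max k l)))"
    using kl(1) up[of k False] by simp
  moreover have "content_upto n (\<Union>k. sec True (U k)) \<le> content_upto n (sec True (U (max k l)))"
    using kl(2) up[of l True] by simp
  ultimately have "content_upto (Suc n) (\<Union>k. U k) \<le> content_upto (Suc n) (U (max k l))"
    using r_pos unfolding content_upto.simps sec_simps
    by (intro min.mono order_refl mult_left_mono add_mono) auto
  then show ?case ..
qed

lemma content_Union_incseq: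
  assumes "\<And>k. opn (U k)" "incseq U" "\<And>k. content (U k) \<le> c"
  shows "content (\<Union>k. U k) \<le> c"
proof (rule content_least)
  fix n
  obtain k where "content_upto n (\<Union>k. U k) \<le> content_upto n (U k)"
    using content_upto_Union_incseq[OF assms(1,2)] by blast
  also have "\<dots> \<le> c"
    using content_upto_le_content[of n "U k"] assms(3)[of k] by simp
  finally show "content_upto n (\<Union>k. U k) \<le> c" .
qed

text \<open>The base case of submodularity. By compactness there is one \<open>n\<close> such that
  every cylinder of length \<open>n\<close> lies in \<open>U\<close> or in \<open>V\<close>; the
  bound is then carried up the tree from this level.\<close>

lemma content_cover_UNIV:
  assumes U: "opn U" and V: "opn V" and UV: "U \<union> V = UNIV"
  shows "1 \<le> content U + content V"
proof -
  define W where "W n = {x. ball_at n x \<subseteq> U \<or> ball_at n x \<subseteq> V}" for n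
  have ball_eq: "y \<in> ball_at n x \<Longrightarrow> ball_at n y = ball_at n x" for n x y
    by (auto simp: ball_at_def)
  have "\<exists>n. W n = UNIV"
  proof (rule cantor_compact)
    show "opn (W n)" for n
      unfolding opn_def
    proof
      fix x
      assume "x \<in> W n"
      then have "ball_at n x \<subseteq> W n"
        using ball_eq by (auto simp: W_def)
      then show "\<exists>n'. ball_at n' x \<subseteq> W n" ..
    qed
    show "W n \<subseteq> W (Suc n)" for n
      using ball_at_antimono[of n "Suc n"] unfolding W_def by fastforce
    have "\<exists>n. x \<in> W n" for x
    proof (cases "x \<in> U")
      case True
      then obtain n where "ball_at n x \<subseteq> U"
        using U unfolding opn_def by blast
      then show ?thesis
        unfolding W_def by blast
    next
      case False
      then have "x \<in> V"
        using UV by blast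
      then obtain n where "ball_at n x \<subseteq> V"
        using V unfolding opn_def by blast
      then show ?thesis
        unfolding W_def by blast
    qed
    then show "(\<Union>n. W n) = UNIV"
      by auto
  qed
  then obtain n where "W n = UNIV" ..
  then have "x \<in> W n" for x
    by simp
  then have "ball_at n x \<subseteq> U \<or> ball_at n x \<subseteq> V" for x
    by (simp add: W_def)
  then show ?thesis
  proof (induction n arbitrary: U V)
    case 0
    then have "U = UNIV \<or> V = UNIV"
      by (auto simp: ball_at_def)
    then show ?case
      using content_UNIV content_nonneg[of U] content_nonneg[of V] by auto
  next
    case (Suc n)
    have "1 \<le> content (sec b U) + content (sec b V)" for b
    proof (rule Suc.IH)
      fix x
      have "ball_at (Suc n) (case_nat b x) \<subseteq> U \<or> ball_at (Suc n) (case_nat b x) \<subseteq> V"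
        by (rule Suc.prems)
      then show "ball_at n x \<subseteq> sec b U \<or> ball_at n x \<subseteq> sec b V"
        by (auto simp: sec_def subset_iff ball_at_Suc_case_nat)
    qed
    \<comment> \<open>If neither content is truncated at this node, they sum to at least
      \<open>2 * r\<close>, hence to at least 1; a truncated one is 1 by itself.\<close>
    from this[of False] this[of True]
    have "2 \<le> (content (sec False U) + content (sec True U)) + (content (sec False V) + content (sec True V))"
      by simp
    then have "r * 2 \<le> r * ((content (sec False U) + content (sec True U)) +
        (content (sec False V) + content (sec True V)))"
      using r_pos by (intro mult_left_mono) auto
    then have "1 \<le> r * (content (sec False U) + content (sec True U)) +
        r * (content (sec False V) + content (sec True V))"
      using r_ge by (simp add: distrib_left)
    then show ?case
      using content_nonneg[of U] content_nonneg[of V] content_rec[of U] content_rec[of V]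
      by (auto simp: min_def split: if_splits)
  qed
qed

lemma content_submodular:
  assumes "opn U" "opn V"
  shows "content (U \<union> V) + content (U \<inter> V) \<le> content U + content V"
proof -
  \<comment> \<open>Only the left side is approximated: at depth 0 the approximations of
    \<open>U\<close> and \<open>V\<close> may both vanish although their union is the whole
    space.\<close>
  have "content_upto n (U \<union> V) + content_upto n (U \<inter> V) \<le> content U + content V" for n
    using assms
  proof (induction n arbitrary: U V)
    case 0
    show ?case
      using content_cover_UNIV[OF 0] content_nonneg[of U] content_nonneg[of V] content_UNIV by auto
  next
    case (Suc n)
    let ?c = "r * (content_upto n (sec False (U \<union> V)) + content_upto n (sec True (U \<union> V)))"
    let ?d = "r * (content_upto n (sec False (U \<inter> V)) + content_upto n (sec True (U \<inter> V)))"
    let ?a = "r * (content (sec False U) + content (sec True U))"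
    let ?b = "r * (content (sec False V) + content (sec True V))"
    have IH: "content_upto n (sec b (U \<union> V)) + content_upto n (sec b (U \<inter> V)) \<le> content (sec b U) + content (sec b V)" for b
      using Suc.IH[OF opn_sec[OF Suc.prems(1)] opn_sec[OF Suc.prems(2)], of b b] by simp
    have "r * ((content_upto n (sec False (U \<union> V)) + content_upto n (sec False (U \<inter> V))) +
        (content_upto n (sec True (U \<union> V)) + content_upto n (sec True (U \<inter> V)))) \<le>
        r * ((content (sec False U) + content (sec False V)) + (content (sec True U) + content (sec True V)))"
      using r_pos by (intro mult_left_mono add_mono IH) auto
    then have cd: "?c + ?d \<le> ?a + ?b"
      by (simp add: algebra_simps)
    have "content_upto n (sec b (U \<inter> V)) \<le> content (sec b U)" "content_upto n (sec b (U \<inter> V)) \<le> content (sec b V)" for b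
      using content_upto_le_content[of n "sec b (U \<inter> V)"] content_mono[of "sec b (U \<inter> V)" "sec b U"]
        content_mono[of "sec b (U \<inter> V)" "sec b V"] by auto
    then have d: "?d \<le> ?a" "?d \<le> ?b"
      using r_pos by (auto intro!: mult_left_mono add_mono simp del: sec_simps)
    \<comment> \<open>If \<open>?a\<close> or \<open>?b\<close> is at least 1, its truncation
      dominates \<open>min 1 ?c\<close> and the other one dominates \<open>min 1 ?d\<close>;
      otherwise the inequality \<open>cd\<close> suffices.\<close>
    have "min 1 ?c + min 1 ?d \<le> min 1 ?a + min 1 ?b"
      using cd d by (auto simp: min_def simp del: sec_simps)
    then show ?case
      unfolding content_upto.simps content_rec[of U] content_rec[of V] .
  qed
  then show ?thesis
    by (intro LIMSEQ_le_const2[OF tendsto_add[OF content_upto_tendsto content_upto_tendsto]]) auto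
qed

lemma content_Union_le:
  assumes "\<And>i. opn (U i)" "\<And>n :: nat. (\<Sum>i<n. content (U i)) \<le> c"
  shows "content (\<Union>i. U i) \<le> c"
proof -
  have fin: "content (\<Union>i<n. U i) \<le> (\<Sum>i<n. content (U i))" for n :: nat
  proof (induction n)
    case 0
    then show ?case by (simp add: content_empty)
  next
    case (Suc n)
    have "content (\<Union>i<Suc n. U i) \<le> content (\<Union>i<n. U i) + content (U n)"
      using content_submodular[of "\<Union>i<n. U i" "U n"] content_nonneg[of "(\<Union>i<n. U i) \<inter> U n"]
        opn_Union[of "{..<n}" U] assms(1)
      by (simp add: lessThan_Suc Un_commute)
    then show ?case
      using Suc by simp
  qed
  have "content (\<Union>n. \<Union>i<n. U i) \<le> c"
  proof (rule content_Union_incseq)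
    show "content (\<Union>i<n. U i) \<le> c" for n
      using fin[of n] assms(2)[of n] by simp
    show "opn (\<Union>i<n. U i)" for n
      by (intro opn_Union assms)
    show "incseq (\<lambda>n. \<Union>i<n. U i)"
      by (intro monoI UN_mono) auto
  qed
  moreover have "(\<Union>n. \<Union>i<n. U i) = (\<Union>i. U i)"
    by blast
  ultimately show ?thesis by simp
qed

subsection \<open>The outer content and increasing unions\<close>

text \<open>As \<open>content\<close> approximates from within, it suits open sets; arbitrary sets
  are measured through their open supersets.\<close>

definition outer_content :: "cantor set \<Rightarrow> real" where
  "outer_content A = (INF U \<in> {U. opn U \<and> A \<subseteq> U}. content U)"

lemma outer_content_le: "opn U \<Longrightarrow> A \<subseteq> U \<Longrightarrow> outer_content A \<le> content U"
  unfolding outer_content_def by (rule cINF_lower) (auto intro: bdd_belowI content_nonneg)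

lemma outer_content_greatest: "(\<And>U. opn U \<Longrightarrow> A \<subseteq> U \<Longrightarrow> c \<le> content U) \<Longrightarrow> c \<le> outer_content A"
  unfolding outer_content_def by (rule cINF_greatest) (use opn_UNIV in auto)

lemma outer_content_nonneg: "0 \<le> outer_content A"
  by (intro outer_content_greatest content_nonneg)

lemma outer_content_mono: "A \<subseteq> B \<Longrightarrow> outer_content A \<le> outer_content B"
  by (intro outer_content_greatest outer_content_le) auto

lemma outer_content_less:
  assumes "outer_content A < c"
  obtains U where "opn U" "A \<subseteq> U" "content U < c"
  using outer_content_greatest[of A c] assms by (metis not_le)

text \<open>Plain subadditivity of nearly optimal open supersets would add up their contents. Strong
  subadditivity subtracts the content of the intersection with the next superset, which still covers
  \<open>A n\<close>, so only the errors accumulate.\<close>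

lemma outer_content_Union_incseq:
  assumes inc: "incseq A" and le: "\<And>n. outer_content (A n) \<le> c"
  shows "outer_content (\<Union>n. A n) \<le> c"
proof (rule field_le_epsilon)
  fix e :: real
  assume e: "0 < e"
  have "\<exists>U. opn U \<and> A n \<subseteq> U \<and> content U < outer_content (A n) + e / 2 ^ Suc n" for n
    using outer_content_less[of "A n" "outer_content (A n) + e / 2 ^ Suc n"] e by (metis less_add_same_cancel1 zero_less_divide_iff zero_less_numeral zero_less_power)
  then obtain U where U: "\<And>n. opn (U n)" "\<And>n. A n \<subseteq> U n"
    "\<And>n. content (U n) < outer_content (A n) + e / 2 ^ Suc n"
    by metis
  define W where "W n = (\<Union>i\<le>n. U i)" for n
  have opnW: "opn (W n)" for n
    unfolding W_def using U(1) by (intro opn_Union)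
  have AW: "A n \<subseteq> W n" for n
    using U(2) by (auto simp: W_def)
  \<comment> \<open>The factor of \<open>e\<close> is the sum of the errors
    \<open>1 / 2 ^ Suc k\<close> for \<open>k \<le> n\<close>.\<close>
  have W: "content (W n) \<le> outer_content (A n) + e * (1 - 1 / 2 ^ Suc n)" for n
  proof (induction n)
    case 0
    then show ?case
      using U(3)[of 0] by (simp add: W_def)
  next
    case (Suc n)
    have "W (Suc n) = W n \<union> U (Suc n)"
      by (auto simp: W_def atMost_Suc)
    then have "content (W (Suc n)) + content (W n \<inter> U (Suc n)) \<le> content (W n) + content (U (Suc n))"
      using content_submodular[OF opnW U(1)] by simp
    moreover have "outer_content (A n) \<le> content (W n \<inter> U (Suc n))"
      using AW[of n] U(2)[of "Suc n"] incseq_SucD[OF inc, of n]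
      by (intro outer_content_le opn_Int opnW U(1)) auto
    ultimately have "content (W (Suc n)) \<le>
        e * (1 - 1 / 2 ^ Suc n) + (outer_content (A (Suc n)) + e / 2 ^ Suc (Suc n))"
      using Suc U(3)[of "Suc n"] by linarith
    also have "\<dots> = outer_content (A (Suc n)) + e * (1 - 1 / 2 ^ Suc (Suc n))"
      by (simp add: field_simps)
    finally show ?case .
  qed
  have "content (\<Union>n. W n) \<le> c + e"
  proof (rule content_Union_incseq[OF opnW])
    show "incseq W"
      by (force simp: W_def mono_def)
    have "e * (1 - 1 / 2 ^ Suc n) \<le> e" for n
      using e by (simp add: mult_left_le)
    then show "content (W n) \<le> c + e" for n
      using W[of n] le[of n] by (smt (verit))
  qed
  moreover have "outer_content (\<Union>n. A n) \<le> content (\<Union>n. W n)"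
    using AW opnW by (intro outer_content_le opn_Union) auto
  ultimately show "outer_content (\<Union>n. A n) \<le> c + e"
    by simp
qed

lemma content_1_sec:
  "content U \<noteq> 1 \<Longrightarrow> content U = r * content (sec False U) + r * content (sec True U)"
  using content_rec[of U] by (auto simp: min_def distrib_left split: if_splits)

end

subsection \<open>Efficient covers by cylinders\<close>

fun cyl :: "bool list \<Rightarrow> cantor set" where
  "cyl [] = UNIV"
| "cyl (b # bs) = {x. x 0 = b \<and> (\<lambda>i. x (Suc i)) \<in> cyl bs}"

lemma cyl_agree: "x \<in> cyl bs \<Longrightarrow> y \<in> cyl bs \<Longrightarrow> i < length bs \<Longrightarrow> x i = y i"
proof (induction bs arbitrary: x y i)
  case (Cons b bs)
  then show ?case
    using Cons.IH[of "\<lambda>i. x (Suc i)" "\<lambda>i. y (Suc i)" "i - 1"] by (cases i) auto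
qed simp

context dyadic_content
begin

text \<open>The cost of these shortest cylinders of full content is controlled because the truncation in
  the recursion for \<open>content\<close> is inactive above them.\<close>

fun full_cyls :: "nat \<Rightarrow> cantor set \<Rightarrow> bool list set" where
  "full_cyls 0 U = (if content U = 1 then {[]} else {})"
| "full_cyls (Suc n) U = (if content U = 1 then {[]} else
     Cons False ` full_cyls n (sec False U) \<union> Cons True ` full_cyls n (sec True U))"

lemma finite_full_cyls: "finite (full_cyls n U)"
  by (induction n arbitrary: U) auto

lemma full_cyls_Suc: "full_cyls n U \<subseteq> full_cyls (Suc n) U"
proof (induction n arbitrary: U)
  case (Suc n)
  then show ?case
    by (subst (1 2) full_cyls.simps(2)) (auto simp del: full_cyls.simps)
qed auto

lemma full_cyls_cost: "(\<Sum>bs\<in>full_cyls n U. r ^ length bs) \<le> content U"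
proof (induction n arbitrary: U)
  case 0
  then show ?case using content_nonneg by simp
next
  case (Suc n)
  show ?case
  proof (cases "content U = 1")
    case False
    have c: "(\<Sum>bs\<in>Cons b ` full_cyls n (sec b U). r ^ length bs) \<le> r * content (sec b U)" for b
      using Suc[of "sec b U"] r_pos
      by (simp add: sum.reindex sum_distrib_left[symmetric] mult_left_mono)
    have "(\<Sum>bs\<in>full_cyls (Suc n) U. r ^ length bs) =
        (\<Sum>bs\<in>Cons False ` full_cyls n (sec False U). r ^ length bs) +
        (\<Sum>bs\<in>Cons True ` full_cyls n (sec True U). r ^ length bs)"
      using False finite_full_cyls by (simp, intro sum.union_disjoint) auto
    also have "\<dots> \<le> r * content (sec False U) + r * content (sec True U)"
      by (intro add_mono c)
    finally show ?thesis
      using content_1_sec[OF False] by simp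
  qed simp
qed

text \<open>The section at a cylinder inside \<open>U\<close> is the whole space and has content 1,
  so the descent towards \<open>x\<close> stops there or earlier.\<close>

lemma full_cyls_cover: "ball_at n x \<subseteq> U \<Longrightarrow> \<exists>bs\<in>full_cyls n U. x \<in> cyl bs"
proof (induction n arbitrary: x U)
  case 0
  then have "U = UNIV"
    by (auto simp: ball_at_def)
  then show ?case
    by (simp add: content_UNIV)
next
  case (Suc n)
  show ?case
  proof (cases "content U = 1")
    case False
    have "ball_at n (\<lambda>i. x (Suc i)) \<subseteq> sec (x 0) U"
      using Suc.prems by (auto simp: sec_def ball_at_Suc_case_nat subset_iff)
    then obtain bs where "bs \<in> full_cyls n (sec (x 0) U)" "(\<lambda>i. x (Suc i)) \<in> cyl bs"
      using Suc.IH by blast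
    then show ?thesis
      using False by (intro bexI[of _ "x 0 # bs"]) (cases "x 0"; auto)+
  qed auto
qed

text \<open>The stages \<open>full_cyls n U\<close> increase, so a finite subfamily of their union
  lies in a single stage, where the cost is already bounded.\<close>

lemma countable_efficient_cover:
  assumes "opn U"
  shows "\<exists>W. U \<subseteq> (\<Union>bs\<in>W. cyl bs) \<and>
    (\<forall>F. finite F \<longrightarrow> F \<subseteq> W \<longrightarrow> (\<Sum>bs\<in>F. r ^ length bs) \<le> content U)"
proof (intro exI conjI allI impI)
  let ?W = "\<Union>n. full_cyls n U"
  show "U \<subseteq> (\<Union>bs\<in>?W. cyl bs)"
  proof
    fix x
    assume "x \<in> U"
    then obtain n where "ball_at n x \<subseteq> U"
      using assms unfolding opn_def by blast
    then obtain bs where "bs \<in> full_cyls n U" "x \<in> cyl bs"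
      using full_cyls_cover by blast
    then show "x \<in> (\<Union>bs\<in>?W. cyl bs)"
      by blast
  qed
  show "(\<Sum>bs\<in>F. r ^ length bs) \<le> content U" if F: "finite F" "F \<subseteq> ?W" for F
  proof -
    have "\<exists>n. F \<subseteq> full_cyls n U"
      using F
    proof (induction rule: finite_induct)
      case (insert bs F)
      then obtain m where "bs \<in> full_cyls m U"
        by blast
      moreover obtain n where "F \<subseteq> full_cyls n U"
        using insert by blast
      moreover have "full_cyls m U \<subseteq> full_cyls (max m n) U" "full_cyls n U \<subseteq> full_cyls (max m n) U"
        by (rule lift_Suc_mono_le[of "\<lambda>n. full_cyls n U", OF full_cyls_Suc], simp)+
      ultimately have "insert bs F \<subseteq> full_cyls (max m n) U"
        by blast
      then show ?case ..
    qed simp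
    then obtain n where "F \<subseteq> full_cyls n U" ..
    then have "(\<Sum>bs\<in>F. r ^ length bs) \<le> (\<Sum>bs\<in>full_cyls n U. r ^ length bs)"
      using r_pos by (intro sum_mono2 finite_full_cyls) auto
    then show ?thesis
      using full_cyls_cost[of n U] by simp
  qed
qed

end

subsection \<open>Comparison with Hausdorff measure\<close>

lemma cdist_le_1: "cdist x y \<le> 1"
  by (auto simp: cdist_def power_le_one)

lemma cdist_nonneg: "0 \<le> cdist x y"
  by (auto simp: cdist_def)

lemma cdist_agree: "(\<And>i. i < n \<Longrightarrow> x i = y i) \<Longrightarrow> cdist x y \<le> (1/2) ^ n"
proof -
  assume agree: "\<And>i. i < n \<Longrightarrow> x i = y i"
  show ?thesis
  proof (cases "x = y")
    case False
    then obtain k where "x k \<noteq> y k"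
      by blast
    then have "x (LEAST n. x n \<noteq> y n) \<noteq> y (LEAST n. x n \<noteq> y n)"
      by (rule LeastI)
    then have "n \<le> (LEAST n. x n \<noteq> y n)"
      using agree by (meson not_le)
    then show ?thesis
      using False by (auto simp: cdist_def intro!: power_decreasing)
  qed (simp add: cdist_def)
qed

lemma cdist_differ: "x n \<noteq> y n \<Longrightarrow> (1/2) ^ n \<le> cdist x y"
  by (auto simp: cdist_def intro!: power_decreasing Least_le)

lemma cdist_le_cdiam: "x \<in> U \<Longrightarrow> y \<in> U \<Longrightarrow> cdist x y \<le> cdiam U"
  unfolding cdiam_def by (auto intro!: cSup_upper bdd_aboveI[of _ 1] cdist_le_1)

lemma cdiam_le:
  assumes "\<And>x y. x \<in> U \<Longrightarrow> y \<in> U \<Longrightarrow> cdist x y \<le> d" "0 \<le> d"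
  shows "cdiam U \<le> d"
proof (cases "U = {}")
  case False
  then have "{cdist x y | x y. x \<in> U \<and> y \<in> U} \<noteq> {}"
    by blast
  then have "Sup {cdist x y | x y. x \<in> U \<and> y \<in> U} \<le> d"
    by (rule cSup_least) (use assms(1) in blast)
  with False show ?thesis
    by (simp add: cdiam_def)
qed (use assms(2) in \<open>simp add: cdiam_def\<close>)

lemma cdiam_nonneg: "0 \<le> cdiam U"
proof (cases "U = {}")
  case False
  then obtain x where "x \<in> U" by blast
  then show ?thesis
    using cdist_le_cdiam[of x U x] cdist_nonneg[of x x] by simp
qed (simp add: cdiam_def)

lemma cdiam_cyl: "cdiam (cyl bs) \<le> (1/2) ^ length bs"
proof (rule cdiam_le)
  show "cdist x y \<le> (1/2) ^ length bs" if "x \<in> cyl bs" "y \<in> cyl bs" for x y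
    by (rule cdist_agree) (rule cyl_agree[OF that])
qed simp

locale hausdorff_content = dyadic_content r for r +
  fixes s :: real
  assumes s_pos: "0 < s" and r_eq: "r = (1/2) powr s"
begin

lemma r_power: "r ^ n = ((1/2) ^ n) powr s"
proof -
  have "r ^ n = r powr real n"
    using r_pos by (rule powr_realpow[symmetric])
  also have "\<dots> = ((1/2) powr real n) powr s"
    unfolding r_eq powr_powr by (simp only: mult.commute)
  also have "(1/2 :: real) powr real n = (1/2) ^ n"
    by (rule powr_realpow) simp
  finally show ?thesis .
qed

text \<open>If \<open>n\<close> is the first level at which two points of \<open>U\<close> differ,
  \<open>U\<close> lies in a cylinder whose cost \<open>r ^ n\<close> is at most
  \<open>cdiam U powr s\<close>. The slack \<open>e\<close> pays for sets with at most one point, of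
  diameter 0, which are enclosed in a small cylinder.\<close>

lemma open_superset_cost:
  assumes "0 < e"
  obtains V where "opn V" "U \<subseteq> V" "content V \<le> cdiam U powr s + e"
proof (cases "\<exists>n. \<exists>x\<in>U. \<exists>y\<in>U. x n \<noteq> y n")
  case True
  define n where "n = (LEAST n. \<exists>x\<in>U. \<exists>y\<in>U. x n \<noteq> y n)"
  have "\<exists>x\<in>U. \<exists>y\<in>U. x n \<noteq> y n"
    unfolding n_def by (rule LeastI_ex[OF True])
  then obtain x y where xy: "x \<in> U" "y \<in> U" "x n \<noteq> y n"
    by blast
  have "z i = x i" if "z \<in> U" "i < n" for z i
    using not_less_Least[OF that(2)[unfolded n_def]] that(1) xy(1) by blast
  then have U: "U \<subseteq> ball_at n x"
    by (auto simp: ball_at_def)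
  have "(1/2) ^ n \<le> cdiam U"
    using cdist_differ[of x n y] cdist_le_cdiam[of x U y] xy by auto
  then have "r ^ n \<le> cdiam U powr s"
    unfolding r_power using s_pos by (intro powr_mono2) auto
  then show ?thesis
    using that[OF opn_ball_at U] content_ball_at[of n x] assms by simp
next
  case no_diff: False
  obtain n where n: "r ^ n < e"
    using real_arch_pow_inv[OF assms r_less] by blast
  have "\<exists>x. U \<subseteq> ball_at n x"
  proof (cases "U = {}")
    case False
    then obtain x where "x \<in> U" by blast
    then have "y i = x i" if "y \<in> U" for y i
      using no_diff that by blast
    then have "U \<subseteq> ball_at n x"
      by (simp add: ball_at_def subset_iff)
    then show ?thesis by (rule exI[of _ x])
  qed simp
  then obtain x where "U \<subseteq> ball_at n x" ..
  moreover have "content (ball_at n x) \<le> cdiam U powr s + e"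
    using content_ball_at[of n x] n powr_ge_zero[of "cdiam U" s] by linarith
  ultimately show ?thesis
    using that[OF opn_ball_at] by blast
qed

lemma outer_content_le_hausdorff_approx: "ennreal (outer_content A) \<le> hausdorff_approx s d A"
  unfolding hausdorff_approx_def
proof (rule INF_greatest)
  fix U :: "nat \<Rightarrow> cantor set"
  assume "U \<in> {U. (\<forall>i. cdiam (U i) \<le> d) \<and> A \<subseteq> (\<Union>i. U i)}"
  then have A: "A \<subseteq> (\<Union>i. U i)"
    by blast
  let ?S = "\<Sum>i. ennreal (cdiam (U i) powr s)"
  show "ennreal (outer_content A) \<le> ?S"
  proof (cases "?S = top")
    case False
    obtain S where S: "?S = ennreal S" "0 \<le> S"
      by (rule ennreal_cases[of ?S]) (use False in blast)+
    have sumS: "(\<Sum>i<n. cdiam (U i) powr s) \<le> S" for n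
    proof -
      have "ennreal (\<Sum>i<n. cdiam (U i) powr s) = (\<Sum>i<n. ennreal (cdiam (U i) powr s))"
        by (simp add: sum_ennreal)
      also have "\<dots> \<le> ?S"
        by (rule sum_le_suminf) auto
      finally show ?thesis
        using S by simp
    qed
    have "outer_content A \<le> S"
    proof (rule field_le_epsilon)
      fix e :: real
      assume e: "0 < e"
      have "\<exists>V. opn V \<and> U i \<subseteq> V \<and> content V \<le> cdiam (U i) powr s + e * (1/2) ^ Suc i" for i
      proof -
        have "0 < e * (1/2) ^ Suc i"
          using e by simp
        from open_superset_cost[OF this, of "U i"] show ?thesis
          by blast
      qed
      then obtain V where V: "\<And>i. opn (V i)" "\<And>i. U i \<subseteq> V i"
        "\<And>i. content (V i) \<le> cdiam (U i) powr s + e * (1/2) ^ Suc i"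
        by metis
      have geo: "(\<Sum>i<n. (1/2) ^ Suc i) \<le> (1 :: real)" for n :: nat
      proof -
        have "(\<Sum>i<n. (1/2) ^ Suc i) = 1 - (1/2 :: real) ^ n"
          by (induction n) auto
        then show ?thesis by simp
      qed
      have "(\<Sum>i<n. content (V i)) \<le> S + e" for n
      proof -
        have "(\<Sum>i<n. content (V i)) \<le> (\<Sum>i<n. cdiam (U i) powr s + e * (1/2) ^ Suc i)"
          by (intro sum_mono V(3))
        also have "\<dots> = (\<Sum>i<n. cdiam (U i) powr s) + e * (\<Sum>i<n. (1/2) ^ Suc i)"
          by (simp only: sum.distrib sum_distrib_left)
        also have "\<dots> \<le> S + e * 1"
          using e by (intro add_mono sumS mult_left_mono geo) auto
        finally show ?thesis by simp
      qed
      then have "content (\<Union>i. V i) \<le> S + e"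
        by (intro content_Union_le V(1))
      moreover have "outer_content A \<le> content (\<Union>i. V i)"
      proof (rule outer_content_le)
        show "opn (\<Union>i. V i)"
          by (intro opn_Union V(1))
        show "A \<subseteq> (\<Union>i. V i)"
        proof (rule order_trans[OF A])
          show "(\<Union>i. U i) \<subseteq> (\<Union>i. V i)"
            by (intro UN_mono order_refl V(2))
        qed
      qed
      ultimately show "outer_content A \<le> S + e"
        by simp
    qed
    then show ?thesis
      using S by (simp add: ennreal_leI)
  qed simp
qed

lemma hausdorff_measure_pos:
  assumes "0 < outer_content A"
  shows "0 < hausdorff_measure s A"
proof -
  have "0 < ennreal (outer_content A)"
    using assms by simp
  also have "\<dots> \<le> hausdorff_approx s 1 A"
    by (rule outer_content_le_hausdorff_approx)
  also have "\<dots> \<le> hausdorff_measure s A"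
    unfolding hausdorff_measure_def by (rule SUP_upper) simp
  finally show ?thesis .
qed

text \<open>Small content forces small cylinders: each one in an efficient cover costs less than
  \<open>d powr s\<close>, hence has diameter below \<open>d\<close>, and the cover is admissible at
  scale \<open>d\<close>. This is why content 0 implies measure 0.\<close>

lemma hausdorff_approx_le_content:
  assumes "opn U" "A \<subseteq> U" "content U < d powr s" "0 < d"
  shows "hausdorff_approx s d A \<le> ennreal (content U)"
proof -
  obtain W :: "bool list set" where W: "U \<subseteq> (\<Union>bs\<in>W. cyl bs)"
    "\<forall>F. finite F \<longrightarrow> F \<subseteq> W \<longrightarrow> (\<Sum>bs\<in>F. r ^ length bs) \<le> content U"
    using countable_efficient_cover[OF assms(1)] by blast
  \<comment> \<open>Indices that code no string in \<open>W\<close> get the empty set, whose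
    diameter and weight are 0.\<close>
  define C where "C i = (if i \<in> to_nat ` W then cyl (from_nat i) else {})" for i :: nat
  have diam: "cdiam (C (to_nat bs)) powr s \<le> r ^ length bs" for bs :: "bool list"
  proof (cases "bs \<in> W")
    case True
    then show ?thesis
      unfolding r_power using cdiam_cyl[of bs] cdiam_nonneg s_pos
      by (auto simp: C_def intro!: powr_mono2)
  next
    case False
    then show ?thesis
      using r_pos s_pos by (auto simp: C_def cdiam_def)
  qed
  have out: "C i = {}" if "i \<notin> to_nat ` W" for i
    using that by (simp add: C_def)
  have "cdiam (C i) \<le> d" for i
  proof (cases "i \<in> to_nat ` W")
    case True
    then obtain bs where bs: "bs \<in> W" "i = to_nat bs" by blast
    have "r ^ length bs < d powr s"
      using W(2)[rule_format, of "{bs}"] bs(1) assms(3) by simp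
    then have "(1/2) ^ length bs < d"
      unfolding r_power using s_pos assms(4)
      by (metis not_le powr_mono2 less_imp_le)
    then show ?thesis
      using cdiam_cyl[of bs] bs by (simp add: C_def)
  next
    case False
    then show ?thesis
      using out assms(4) by (simp add: cdiam_def)
  qed
  moreover have "A \<subseteq> (\<Union>i. C i)"
  proof
    fix x
    assume "x \<in> A"
    then obtain bs where "bs \<in> W" "x \<in> cyl bs"
      using assms(2) W(1) by blast
    then show "x \<in> (\<Union>i. C i)"
      by (intro UN_I[of "to_nat bs"]) (auto simp: C_def)
  qed
  ultimately have "hausdorff_approx s d A \<le> (\<Sum>i. ennreal (cdiam (C i) powr s))"
    unfolding hausdorff_approx_def by (intro INF_lower) auto
  also have "\<dots> \<le> ennreal (content U)"
  proof (rule suminf_le_const[OF summableI])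
    fix n
    let ?F = "{bs \<in> W. to_nat bs < n}"
    have fin: "finite ?F"
      by (rule finite_imageD[of to_nat]) (auto intro: finite_subset[of _ "{..<n}"] inj_on_subset[OF inj_to_nat])
    have "(\<Sum>i<n. cdiam (C i) powr s) = (\<Sum>i\<in>to_nat ` ?F. cdiam (C i) powr s)"
      by (rule sum.mono_neutral_right) (use out s_pos in \<open>force simp: cdiam_def\<close>)+
    also have "\<dots> = (\<Sum>bs\<in>?F. cdiam (C (to_nat bs)) powr s)"
      by (simp add: sum.reindex inj_on_subset[OF inj_to_nat])
    also have "\<dots> \<le> (\<Sum>bs\<in>?F. r ^ length bs)"
      by (intro sum_mono diam)
    also have "\<dots> \<le> content U"
      using W(2) fin by blast
    finally show "(\<Sum>i<n. ennreal (cdiam (C i) powr s)) \<le> ennreal (content U)"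
      by (simp add: sum_ennreal ennreal_leI)
  qed
  finally show ?thesis .
qed

lemma outer_content_pos:
  assumes "0 < hausdorff_measure s A"
  shows "0 < outer_content A"
proof (rule ccontr)
  assume "\<not> 0 < outer_content A"
  then have "outer_content A = 0"
    using outer_content_nonneg[of A] by simp
  have "hausdorff_approx s d A = 0" if d: "0 < d" for d
  proof -
    have le: "hausdorff_approx s d A \<le> ennreal e" if e: "0 < e" for e
    proof -
      obtain U where U: "opn U" "A \<subseteq> U" "content U < min e (d powr s)"
        by (rule outer_content_less[of A "min e (d powr s)"]) (use \<open>outer_content A = 0\<close> e d in auto)
      then have "hausdorff_approx s d A \<le> ennreal (content U)"
        by (intro hausdorff_approx_le_content d) auto
      also have "\<dots> \<le> ennreal e"
        using U(3) by (intro ennreal_leI) simp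
      finally show ?thesis .
    qed
    have "hausdorff_approx s d A \<le> 0"
    proof (rule ennreal_le_epsilon)
      show "hausdorff_approx s d A \<le> 0 + ennreal e" if "0 < e" for e
        using le[OF that] by simp
    qed
    then show ?thesis by simp
  qed
  then have "hausdorff_measure s A \<le> 0"
    unfolding hausdorff_measure_def by (intro SUP_least) simp
  with assms show False by simp
qed

end

subsection \<open>Compact sections of large content\<close>

definition prefix_section :: "rcode \<Rightarrow> nat list \<Rightarrow> cantor set" where
  "prefix_section c xs =
     {z. \<exists>h. (\<forall>i<length xs. h i \<le> xs ! i) \<and> \<not> halts (ojoin (b2n z) h) c [0]}"

lemma prefix_section_Union: "prefix_section c xs = (\<Union>j. prefix_section c (xs @ [j]))"
proof (intro equalityI subsetI)
  fix z
  assume "z \<in> prefix_section c xs"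
  then obtain h where h: "\<forall>i<length xs. h i \<le> xs ! i" "\<not> halts (ojoin (b2n z) h) c [0]"
    unfolding prefix_section_def by blast
  have "\<forall>i<length (xs @ [h (length xs)]). h i \<le> (xs @ [h (length xs)]) ! i"
    using h(1) by (auto simp: nth_append less_Suc_eq)
  then have "z \<in> prefix_section c (xs @ [h (length xs)])"
    using h(2) unfolding prefix_section_def by blast
  then show "z \<in> (\<Union>j. prefix_section c (xs @ [j]))"
    by blast
next
  fix z
  assume "z \<in> (\<Union>j. prefix_section c (xs @ [j]))"
  then obtain j h where h: "\<forall>i<length (xs @ [j]). h i \<le> (xs @ [j]) ! i"
    "\<not> halts (ojoin (b2n z) h) c [0]"
    unfolding prefix_section_def by blast
  have "h i \<le> xs ! i" if "i < length xs" for i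
    using h(1)[rule_format, of i] that by (simp add: nth_append)
  then show "z \<in> prefix_section c xs"
    using h(2) unfolding prefix_section_def by blast
qed

lemma incseq_prefix_section: "incseq (\<lambda>j. prefix_section c (xs @ [j]))"
proof (rule monoI, rule subsetI)
  fix j k :: nat and z
  assume jk: "j \<le> k" and "z \<in> prefix_section c (xs @ [j])"
  then obtain h where h: "\<forall>i<length (xs @ [j]). h i \<le> (xs @ [j]) ! i"
    "\<not> halts (ojoin (b2n z) h) c [0]"
    unfolding prefix_section_def by blast
  have "h i \<le> (xs @ [k]) ! i" if "i < length (xs @ [k])" for i
    using h(1)[rule_format, of i] that jk by (auto simp: nth_append split: if_splits)
  then show "z \<in> prefix_section c (xs @ [k])"
    using h(2) unfolding prefix_section_def by blast
qed

lemma bounded_section_mono: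
  assumes "\<And>i. G i \<le> G' i"
  shows "bounded_section c G \<subseteq> bounded_section c G'"
proof
  fix z
  assume "z \<in> bounded_section c G"
  then obtain h where "\<forall>i. h i \<le> G i" "\<not> halts (ojoin (b2n z) h) c [0]"
    unfolding bounded_section_def by blast
  moreover from this(1) have "\<forall>i. h i \<le> G' i"
    using assms order_trans by blast
  ultimately show "z \<in> bounded_section c G'"
    unfolding bounded_section_def by blast
qed

text \<open>A substitute for continuity from above. Points outside \<open>U\<close> with witnesses
  bounded on longer and longer prefixes would accumulate at a point of the bounded section, hence
  inside the open set \<open>U\<close>.\<close>

lemma prefix_section_subset_open:
  assumes U: "opn U" and sub: "bounded_section c G \<subseteq> U"
  shows "\<exists>n. prefix_section c (map G [0..<n]) \<subseteq> U"
proof (rule ccontr)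
  assume "\<nexists>n. prefix_section c (map G [0..<n]) \<subseteq> U"
  then have "\<exists>z. z \<in> prefix_section c (map G [0..<n]) \<and> z \<notin> U" for n
    by blast
  then have "\<exists>z h. z \<notin> U \<and> (\<forall>i<n. h i \<le> G i) \<and> \<not> halts (ojoin (b2n z) h) c [0]" for n
    by (simp add: prefix_section_def) blast
  then obtain z h where zh: "\<And>n. z n \<notin> U" "\<And>n i. i < n \<Longrightarrow> h n i \<le> G i"
    "\<And>n. \<not> halts (ojoin (b2n (z n)) (h n)) c [0]"
    by metis
  \<comment> \<open>Points and witnesses are joined so that a single limit serves both; bits have
    the constant bound 1.\<close>
  let ?F = "\<lambda>n. ojoin (b2n (z n)) (h n)"
  have "?F k i \<le> ojoin (\<lambda>_. 1) G i" if "i < k" for k i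
    using zh(2)[of "i div 2" k] that by (auto simp: ojoin_def b2n_def)
  then obtain f where f: "\<And>i. f i \<le> ojoin (\<lambda>_. 1) G i" "\<And>n. \<exists>k\<ge>n. \<forall>i<n. ?F k i = f i"
    using bounded_sequence_limit[of ?F "ojoin (\<lambda>_. 1) G"] by metis
  define x where "x i \<longleftrightarrow> f (2 * i) = 1" for i
  define g where "g i = f (2 * i + 1)" for i
  have f_join: "f = ojoin (b2n x) g"
  proof
    fix i
    show "f i = ojoin (b2n x) g i"
    proof (cases "even i")
      case True
      then have "f i \<le> 1"
        using f(1)[of i] by (simp add: ojoin_def)
      then show ?thesis
        using True by (auto simp: ojoin_def b2n_def x_def)
    qed (simp add: ojoin_def g_def)
  qed
  have "\<not> halts f c [0]"
  proof
    assume "halts f c [0]"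
    then obtain t v where t: "bev t f c [0] = Suc v"
      unfolding halts_iff_bev by (metis not0_implies_Suc)
    obtain k where "\<forall>i<t. ?F k i = f i"
      using f(2)[of t] by blast
    then have "bev t (?F k) c [0] = Suc v"
      using bev_cong[of t "?F k" f c "[0]"] t by simp
    then show False
      using zh(3)[of k] unfolding halts_iff_bev by (metis nat.distinct(1))
  qed
  moreover have "g i \<le> G i" for i
    using f(1)[of "2 * i + 1"] by (simp add: ojoin_def g_def)
  ultimately have "x \<in> U"
    using sub unfolding bounded_section_def f_join by blast
  then obtain n where n: "ball_at n x \<subseteq> U"
    using U unfolding opn_def by blast
  obtain k where k: "\<forall>i<2 * n. ?F k i = f i"
    using f(2)[of "2 * n"] by blast
  have "z k i = x i" if "i < n" for i
    using k[rule_format, of "2 * i"] that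
    by (auto simp: ojoin_def b2n_def x_def split: if_splits)
  then have "z k \<in> U"
    using n by (auto simp: ball_at_def)
  with zh(1) show False by blast
qed

lemma (in dyadic_content) large_bounded_section:
  assumes pos: "0 < outer_content {z. \<exists>g. \<not> halts (ojoin (b2n z) g) c [0]}"
  shows "\<exists>G. 0 < outer_content (bounded_section c G)"
proof -
  \<comment> \<open>Half of the content leaves a strict inequality at the start;
    \<open>outer_content_Union_incseq\<close> preserves it with the same \<open>e\<close>, so
    nothing is lost over infinitely many steps.\<close>
  define e where "e = outer_content {z. \<exists>g. \<not> halts (ojoin (b2n z) g) c [0]} / 2"
  have e: "0 < e"
    using pos by (simp add: e_def)
  obtain G where G: "\<And>n. e < outer_content (prefix_section c (map G [0..<n]))"
  proof (rule prefix_choice[where P = "\<lambda>xs. e < outer_content (prefix_section c xs)"])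
    show "e < outer_content (prefix_section c [])"
      using pos by (simp add: prefix_section_def e_def)
    show "\<exists>j. e < outer_content (prefix_section c (xs @ [j]))" if "e < outer_content (prefix_section c xs)" for xs
    proof (rule ccontr)
      assume "\<nexists>j. e < outer_content (prefix_section c (xs @ [j]))"
      then have "outer_content (\<Union>j. prefix_section c (xs @ [j])) \<le> e"
        by (intro outer_content_Union_incseq incseq_prefix_section) (simp add: not_less)
      then show False
        using that prefix_section_Union[of c xs] by simp
    qed
  qed blast
  have "e \<le> outer_content (bounded_section c G)"
  proof (rule outer_content_greatest)
    fix U
    assume U: "opn U" "bounded_section c G \<subseteq> U"
    then obtain n where "prefix_section c (map G [0..<n]) \<subseteq> U"
      using prefix_section_subset_open by blast
    then have "outer_content (prefix_section c (map G [0..<n])) \<le> content U"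
      by (rule outer_content_le[OF U(1)])
    with G[of n] show "e \<le> content U"
      by simp
  qed
  with e show ?thesis
    by (intro exI[of _ G]) simp
qed

subsection \<open>Sets computed by all dominating functions\<close>

definition cond :: "nat \<Rightarrow> (nat \<Rightarrow> nat) \<Rightarrow> (nat \<Rightarrow> nat) set" where
  "cond l q = {g. (\<forall>i<l. g i = q i) \<and> (\<forall>i. q i \<le> g i)}"

lemma self_in_cond [simp]: "q \<in> cond l q"
  by (simp add: cond_def)

lemma cond_mono:
  assumes "l \<le> l'" "q' \<in> cond l q"
  shows "cond l' q' \<subseteq> cond l q"
proof
  fix g
  assume g: "g \<in> cond l' q'"
  have "g i = q i" if "i < l" for i
    using assms g that by (simp add: cond_def)
  moreover have "q i \<le> g i" for i
    using assms(2) g order_trans[of "q i" "q' i" "g i"] by (simp add: cond_def)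
  ultimately show "g \<in> cond l q"
    by (simp add: cond_def)
qed

definition computes :: "rcode \<Rightarrow> (nat \<Rightarrow> nat) \<Rightarrow> cantor \<Rightarrow> bool" where
  "computes c g y \<longleftrightarrow> (\<forall>n. eval (b2n (graph g)) c [n] (b2n y n))"

lemma eval_graph_use:
  assumes "eval (b2n (graph g)) c xs v"
  shows "\<exists>t. \<forall>g'. (\<forall>i<t. g' i = g i) \<longrightarrow> eval (b2n (graph g')) c xs v"
proof -
  obtain t where t: "bev t (b2n (graph g)) c xs = Suc v"
    using assms eval_iff_bev by blast
  have "eval (b2n (graph g')) c xs v" if "\<forall>i<t. g' i = g i" for g'
  proof -
    have "bev t (b2n (graph g')) c xs = bev t (b2n (graph g)) c xs"
      by (rule bev_cong, rule graph_cong[of t]) (use that in auto)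
    then show ?thesis
      using t bev_sound by metis
  qed
  then show ?thesis by blast
qed

text \<open>If some \<open>h\<close> forces \<open>v\<close>, density yields a function above
  \<open>h\<close> that computes \<open>y\<close>, so \<open>v\<close> is the value of
  \<open>y\<close>. Conversely \<open>q\<close> itself serves as \<open>h\<close>: a wrong value at
  some \<open>g\<close> would persist on a condition whose stem covers its use, and density yields a
  function there that computes \<open>y\<close>.\<close>

lemma hyperarithmetic_if_dense:
  assumes dense: "\<And>l' q'. l \<le> l' \<Longrightarrow> q' \<in> cond l q \<Longrightarrow> \<exists>g\<in>cond l' q'. computes c g y"
  shows "hyperarithmetic y"
proof -
  let ?A = "\<lambda>v. {n. \<exists>h. \<forall>g. (\<forall>i<l. g i = q i) \<longrightarrow> (\<forall>i\<ge>l. h i \<le> g i) \<longrightarrow>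
      (\<forall>w. eval (b2n (graph g)) c [n] w \<longrightarrow> w = v)}"
  have A: "n \<in> ?A v \<longleftrightarrow> b2n y n = v" for n v
  proof
    assume "n \<in> ?A v"
    then obtain h where h: "\<And>g w. (\<forall>i<l. g i = q i) \<Longrightarrow> (\<forall>i\<ge>l. h i \<le> g i) \<Longrightarrow>
        eval (b2n (graph g)) c [n] w \<Longrightarrow> w = v"
      by blast
    define q' where "q' i = (if i < l then q i else max (q i) (h i))" for i
    have "q' \<in> cond l q"
      by (simp add: cond_def q'_def)
    then obtain g where g: "g \<in> cond l q'" "computes c g y"
      using dense[OF order_refl] by blast
    show "b2n y n = v"
    proof (rule h)
      show "\<forall>i<l. g i = q i"
        using g(1) by (simp add: cond_def q'_def)
      show "\<forall>i\<ge>l. h i \<le> g i"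
      proof (intro allI impI)
        fix i
        assume "l \<le> i"
        then have "h i \<le> q' i"
          by (simp add: q'_def)
        also have "\<dots> \<le> g i"
          using g(1) by (simp add: cond_def)
        finally show "h i \<le> g i" .
      qed
      show "eval (b2n (graph g)) c [n] (b2n y n)"
        using g(2) by (simp add: computes_def)
    qed
  next
    assume v: "b2n y n = v"
    have "w = v" if g: "\<forall>i<l. g i = q i" "\<forall>i\<ge>l. q i \<le> g i"
      and w: "eval (b2n (graph g)) c [n] w" for g w
    proof -
      have gc: "g \<in> cond l q"
        using g unfolding cond_def by (auto simp: not_less[symmetric])
      obtain t where t: "\<And>g'. (\<forall>i<t. g' i = g i) \<Longrightarrow> eval (b2n (graph g')) c [n] w"
        using eval_graph_use[OF w] by blast
      \<comment> \<open>The function \<open>g\<close> becomes a condition of its own, with a stem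
        long enough to preserve the computation of \<open>w\<close>.\<close>
      obtain g' where g': "g' \<in> cond (max l t) g" "computes c g' y"
        using dense[of "max l t" g] gc by auto
      have "eval (b2n (graph g')) c [n] w"
        by (rule t) (use g'(1) in \<open>simp add: cond_def\<close>)
      then show ?thesis
        using g'(2) v eval_deterministic unfolding computes_def by blast
    qed
    then show "n \<in> ?A v"
      by blast
  qed
  have "{n. y n} = ?A 1" "{n. \<not> y n} = ?A 0"
    unfolding set_eq_iff A by (auto simp: b2n_def)
  then show ?thesis
    unfolding hyperarithmetic_def
    using sigma11_forced_value[of l q c 1] sigma11_forced_value[of l q c 0] by simp
qed

text \<open>Otherwise every condition could be strengthened to exclude a given code. Excluding the
  \<open>n\<close>-th code at stage \<open>Suc n\<close> produces a function above \<open>G\<close>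
  that no code reduces \<open>y\<close> to.\<close>

lemma hyperarithmetic_if_modulus:
  assumes modulus: "\<And>g. (\<And>i. G i \<le> g i) \<Longrightarrow> \<exists>c. computes c g y"
  shows "hyperarithmetic y"
proof (rule ccontr)
  assume not_hyp: "\<not> hyperarithmetic y"
  have step: "\<exists>l' q'. l < l' \<and> q' \<in> cond l q \<and> (\<forall>g\<in>cond l' q'. \<not> computes c g y)" for l q c
  proof -
    obtain l' q' where q': "l \<le> l'" "q' \<in> cond l q" "\<forall>g\<in>cond l' q'. \<not> computes c g y"
      using hyperarithmetic_if_dense[of l q c y] not_hyp by blast
    \<comment> \<open>Lengthening the stem keeps the exclusion and makes the stems exhaust all
      arguments, so that the stages converge.\<close>
    have "cond (Suc l') q' \<subseteq> cond l' q'"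
      by (rule cond_mono) auto
    then show ?thesis
      using q' by (intro exI[of _ "Suc l'"] exI[of _ q']) auto
  qed
  have "\<exists>X. X 0 = (0, G) \<and> (\<forall>n. fst (X n) < fst (X (Suc n)) \<and>
      snd (X (Suc n)) \<in> cond (fst (X n)) (snd (X n)) \<and>
      (\<forall>g\<in>cond (fst (X (Suc n))) (snd (X (Suc n))). \<not> computes (from_nat n) g y))"
  proof -
    have "\<exists>X. \<forall>n. (n = 0 \<longrightarrow> X n = (0, G)) \<and> (fst (X n) < fst (X (Suc n)) \<and>
        snd (X (Suc n)) \<in> cond (fst (X n)) (snd (X n)) \<and>
        (\<forall>g\<in>cond (fst (X (Suc n))) (snd (X (Suc n))). \<not> computes (from_nat n) g y))"
    proof (rule dependent_nat_choice)
      fix x :: "nat \<times> (nat \<Rightarrow> nat)" and n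
      obtain l' q' where "fst x < l'" "q' \<in> cond (fst x) (snd x)"
        "\<forall>g\<in>cond l' q'. \<not> computes (from_nat n) g y"
        using step by blast
      then show "\<exists>y'. (Suc n = 0 \<longrightarrow> y' = (0, G)) \<and> fst x < fst y' \<and>
          snd y' \<in> cond (fst x) (snd x) \<and>
          (\<forall>g\<in>cond (fst y') (snd y'). \<not> computes (from_nat n) g y)"
        by (intro exI[of _ "(l', q')"]) auto
    qed simp
    then show ?thesis by blast
  qed
  then obtain X where X0: "X 0 = (0, G)" and lX: "\<And>n. fst (X n) < fst (X (Suc n))"
    and qX: "\<And>n. snd (X (Suc n)) \<in> cond (fst (X n)) (snd (X n))"
    and avoid: "\<And>n g. g \<in> cond (fst (X (Suc n))) (snd (X (Suc n))) \<Longrightarrow> \<not> computes (from_nat n) g y"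
    by blast
  let ?l = "\<lambda>n. fst (X n)" and ?q = "\<lambda>n. snd (X n)"
  have dec: "cond (?l n) (?q n) \<subseteq> cond (?l m) (?q m)" if "m \<le> n" for m n
    using lift_Suc_antimono_le[of "\<lambda>n. cond (?l n) (?q n)" m n]
      cond_mono[OF less_imp_le[OF lX] qX] that by blast
  have len: "n \<le> ?l n" for n
    using lX by (induction n) (auto intro: Suc_leI le_less_trans)
  define H where "H i = ?q (Suc i) i" for i
  have H: "?q n i = H i" if "i < n" for i n
  proof -
    have "?q n \<in> cond (?l (Suc i)) (?q (Suc i))"
      using subsetD[OF dec[of "Suc i" n] self_in_cond] that by simp
    moreover have "i < ?l (Suc i)"
      using len[of "Suc i"] by simp
    ultimately show ?thesis
      by (simp add: cond_def H_def)
  qed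
  have H_cond: "H \<in> cond (?l n) (?q n)" for n
  proof -
    have "(i < ?l n \<longrightarrow> H i = ?q n i) \<and> ?q n i \<le> H i" for i
    proof -
      \<comment> \<open>Stage \<open>n + Suc i\<close> is late enough both to lie below the
        \<open>n\<close>-th condition and to agree with \<open>H\<close> at
        \<open>i\<close>.\<close>
      have "?q (n + Suc i) \<in> cond (?l n) (?q n)"
        using subsetD[OF dec[of n "n + Suc i"] self_in_cond] by simp
      moreover have "?q (n + Suc i) i = H i"
        by (rule H) simp
      ultimately show ?thesis
        unfolding cond_def mem_Collect_eq by metis
    qed
    then show ?thesis
      by (simp add: cond_def)
  qed
  have "G i \<le> H i" for i
    using H_cond[of 0] X0 by (simp add: cond_def)
  then obtain c where "computes c H y"
    using modulus by blast
  moreover have "\<not> computes (from_nat (to_nat c)) H y"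
    by (rule avoid[OF H_cond])
  ultimately show False by simp
qed

theorem mainTheorem15:
  fixes s :: real and E :: "cantor set" and y :: cantor
  assumes "s \<in> \<rat>" and "0 < s" and "s < 1"
    and "sigma11_class E"
    and "hausdorff_measure s E > 0"
    and "\<forall>x. (\<exists>P. pi01_rel x P \<and> P \<subseteq> E \<and> hausdorff_measure s P > 0) \<longrightarrow> turing_le y x"
  shows "hyperarithmetic y"
proof -
  have "(1/2 :: real) powr 1 \<le> (1/2) powr s"
    using assms(3) by (intro powr_mono') auto
  moreover have "(1/2 :: real) powr s < 1"
    using assms(2) by (simp add: powr01_less_one)
  ultimately interpret hausdorff_content "(1/2) powr s" s
    using assms(2) by unfold_locales auto
  obtain c where E: "E = {z. \<exists>g. \<not> halts (ojoin (b2n z) g) c [0]}"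
    using assms(4) unfolding sigma11_class_def by blast
  obtain G where G: "0 < outer_content (bounded_section c G)"
    using large_bounded_section[of c] outer_content_pos[OF assms(5)] unfolding E by blast
  show ?thesis
  proof (rule hyperarithmetic_if_modulus)
    fix g
    assume "\<And>i. G i \<le> g i"
    then have "0 < outer_content (bounded_section c g)"
      using G outer_content_mono[OF bounded_section_mono[of G g c]] by simp
    moreover have "bounded_section c g \<subseteq> E"
      unfolding E bounded_section_def by blast
    ultimately have "turing_le y (graph g)"
      using assms(6) pi01_bounded_section hausdorff_measure_pos by blast
    then show "\<exists>c. computes c g y"
      unfolding turing_le_def computes_def .
  qed
qed

end
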